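(* The module of obstructions $\mathbb{O}_{\mathcal{C}om}$ of the operad $\mathcal{C}om$ of commutative algebras is not acyclic. More precisely, $\mathrm{H}_1(\mathbb{O}_{\mathcal{C}om})\neq0$.
   Context: $\mathbb{K}$ is a field of characteristic $0$; everything is differential graded (homological grading). $\mathbb{S}$-modules are families of dg $\mathbb{K}[\mathbb{S}_n]$-modules, $n\ge0$; $\circ$ is the usual composition product with unit $I$; $M\circ(N,N')$ is the part of $M\circ(N\oplus N')$ linear in $N'$; $M\circ_{(1)}N:=M\circ(I,N)$; $f\circ' g=\sum_j f\otimes(id\otimes\cdots\otimes g\otimes\cdots\otimes id)$ ($g$ in position $j$). Operads $(\mathcal{P},\gamma)$ and cooperads $(\mathcal{C},\Delta)$ are monoids/comonoids for $\circ$; $\gamma_p$, $\Delta_p:\mathcal{C}\to\mathcal{C}\circ_{(1)}\mathcal{C}$ are the partial (co)products. $\mathcal{C}om$ is the operad of (non-unital) commutative associative algebras: $\mathcal{C}om(n)=\mathbb{K}$ with trivial action for $n\ge1$, $\mathcal{C}om(0)=0$. For an augmented operad $\mathcal{P}$ and a coaugmented cooperad $\mathcal{C}$, an operadic twisting morphism is a degree $-1$ map $\alpha:\mathcal{C}\to\mathcal{P}$ with $\partial(\alpha)+\gamma_p(\alpha\circ_{(1)}\alpha)\Delta_p=0$; it is a Koszul morphism if $\mathcal{P}\circ_\alpha\mathcal{C}\to I$ is a quasi-isomorphism, where $\mathcal{P}\circ_\alpha\mathcal{C}$ is $\mathcal{P}\circ\mathcal{C}$ with differential $d_{\mathcal{P}\circ\mathcal{C}}-\delta^l_\alpha$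 and $\delta^l_\alpha$ applies $\Delta$ to one factor $\mathcal{C}$ at a time (via $id\circ'\Delta$), then $\alpha$ to the resulting lower factor, then $\gamma$. For $\mathcal{P}=\mathcal{C}om$ one may take the bar construction $\mathcal{C}=\mathcal{B}(\mathcal{C}om)=\mathcal{F}^c(s\overline{\mathcal{C}om})$ with $\pi:\mathcal{B}(\mathcal{C}om)\to s\overline{\mathcal{C}om}\to\overline{\mathcal{C}om}\to\mathcal{C}om$, or the Koszul dual cooperad $\mathcal{C}om^{\text{!`}}\subset\mathcal{B}(\mathcal{C}om)$ with the restriction $\kappa$ of $\pi$. Given a Koszul morphism $\alpha:\mathcal{C}\to\mathcal{P}$: $L_{\mathcal{P}}:=\mathcal{P}\circ_{(1)}(\mathcal{C}\circ\mathcal{P})$ with differential $d_{\mathcal{P}\circ_{(1)}(\mathcal{C}\circ\mathcal{P})}-\delta^l+\delta^r$, where $\delta^l$ applies $\Delta_p$ to $\mathcal{C}$, then $\alpha$ to the factor nearest the root, and composes the result in $\mathcal{P}$ with the root factor $\mathcal{P}$ and with the upper factors $\mathcal{P}$ not attached to the remaining factor $\mathcal{C}$; $\delta^r$ applies $\Delta_p$ to $\mathcal{C}$, then $\alpha$ to the upper factor, and composes it with the upper factors $\mathcal{P}$ above it. $\Omega_{\mathcal{P}}$ is the coequalizer, in infinitesimal $\mathcal{P}$-bimodules, of $id\circ_{(1)}\gamma$ and $c_2:\mathcal{P}\circ_{(1)}(\mathcal{P}\circ\mathcal{P})\rightrightarrows\mathcal{P}\circ_{(1)}\mathcal{P}$,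 where $c_2$ is $\mathcal{P}\circ_{(1)}(\mathcal{P}\circ\mathcal{P})\xrightarrow{id\circ_{(1)}(id\circ' id)}\mathcal{P}\circ_{(1)}(\mathcal{P}\circ(\mathcal{P},\mathcal{P}))\to(\mathcal{P}\circ\mathcal{P}\circ\mathcal{P})\circ_{(1)}\mathcal{P}\xrightarrow{\gamma\circ\gamma\circ_{(1)}id}\mathcal{P}\circ_{(1)}\mathcal{P}$. Both are right $\mathcal{P}$-modules. With $I$ a left $\mathcal{P}$-module via the augmentation and $\circ_{\mathcal{P}}$ the relative composition product, put $\overline{L}_{\mathcal{P}}:=L_{\mathcal{P}}\circ_{\mathcal{P}}I$ and $\overline{\Omega}_{\mathcal{P}}:=\Omega_{\mathcal{P}}\circ_{\mathcal{P}}I$. The counit $\mathcal{C}\to I$ induces surjections $L_{\mathcal{P}}\to\mathcal{P}\circ_{(1)}\mathcal{P}\to\Omega_{\mathcal{P}}$ and $\overline{L}_{\mathcal{P}}\to\overline{\Omega}_{\mathcal{P}}$. The module of obstructions $\mathbb{O}_{\mathcal{P}}$ is the class, in the homotopy category of infinitesimal left $\mathcal{P}$-modules (independent of $\alpha$), of the dg $\mathbb{S}$-module $O_{\mathcal{P}}:=\ker(\overline{L}_{\mathcal{P}}\to\overline{\Omega}_{\mathcal{P}})$; $\mathrm{H}_\bullet(\mathbb{O}_{\mathcal{P}})=\mathrm{H}_\bullet(O_{\mathcal{P}})$, and acyclic means zero homology. *)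

theory Defs
  imports Complex_Main "HOL-Library.Poly_Mapping" "HOL-Combinatorics.Permutations"
begin

section \<open>Free vector spaces\<close>

text \<open>
  A vector of the free \<open>'k\<close>-vector space on \<open>'g\<close> is a finitely supported function \<open>'g \<Rightarrow>\<^sub>0 'k\<close>.
  Linear maps out of it are given by their values on \<open>'g\<close> and extended with \<open>lin\<close>.
\<close>

abbreviation gen :: "'g \<Rightarrow> 'g \<Rightarrow>\<^sub>0 'k::field"
  where "gen g \<equiv> Poly_Mapping.single g 1"

definition smul :: "'k::field \<Rightarrow> ('g \<Rightarrow>\<^sub>0 'k) \<Rightarrow> 'g \<Rightarrow>\<^sub>0 'k"
  where "smul c x = Poly_Mapping.map ((*) c) x"

definition lin :: "('g \<Rightarrow> 'h \<Rightarrow>\<^sub>0 'k::field) \<Rightarrow> ('g \<Rightarrow>\<^sub>0 'k) \<Rightarrow> 'h \<Rightarrow>\<^sub>0 'k"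
  where "lin f x = (\<Sum>g\<in>Poly_Mapping.keys x. smul (Poly_Mapping.lookup x g) (f g))"

lemma lookup_smul [simp]: "Poly_Mapping.lookup (smul c x) g = c * Poly_Mapping.lookup x g"
  by (simp add: smul_def Poly_Mapping.map.rep_eq when_def)

lemma vector_space_smul: "vector_space (smul :: 'k::field \<Rightarrow> ('g \<Rightarrow>\<^sub>0 'k) \<Rightarrow> _)"
  by unfold_locales (auto intro!: poly_mapping_eqI simp: lookup_add algebra_simps)

abbreviation lspan :: "('g \<Rightarrow>\<^sub>0 'k::field) set \<Rightarrow> ('g \<Rightarrow>\<^sub>0 'k) set"
  where "lspan \<equiv> module.span smul"

text \<open>The tensor product of a list of vectors, with values in the free space on lists.\<close>

primrec tensor :: "('g \<Rightarrow>\<^sub>0 'k::field) list \<Rightarrow> 'g list \<Rightarrow>\<^sub>0 'k" where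
  "tensor [] = gen []"
| "tensor (x # xs) = lin (\<lambda>a. lin (\<lambda>as. gen (a # as)) (tensor xs)) x"


section \<open>Koszul signs\<close>

definition ksgn :: "int \<Rightarrow> 'k::field"
  where "ksgn e = (if even e then 1 else - 1)"

text \<open>
  \<open>reorder_sign ds idx\<close>: sign of rearranging homogeneous elements of degrees \<open>ds\<close>
  into the order \<open>ds ! (idx ! 0), ds ! (idx ! 1), \<dots>\<close>.
\<close>

definition reorder_sign :: "int list \<Rightarrow> nat list \<Rightarrow> 'k::field" where
  "reorder_sign ds idx =
    (- 1) ^ card {(a, b). a < b \<and> b < length idx \<and> idx ! b < idx ! a \<and>
                         odd (ds ! (idx ! a)) \<and> odd (ds ! (idx ! b))}"

text \<open>
  Sign of \<open>a\<^sub>1 b\<^sub>1 a\<^sub>2 b\<^sub>2 \<dots> \<mapsto> a\<^sub>1 a\<^sub>2 \<dots> b\<^sub>1 b\<^sub>2 \<dots>\<close> for the given pairs of degrees \<open>(\<bar>a\<^sub>i\<bar>, \<bar>b\<^sub>i\<bar>)\<close>.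
\<close>

definition unshuffle_sign :: "(int \<times> int) list \<Rightarrow> 'k::field" where
  "unshuffle_sign ab = ksgn (\<Sum>j<length ab. \<Sum>i<j. snd (ab ! i) * fst (ab ! j))"


section \<open>Dg S-modules\<close>

text \<open>
  A dg \<open>\<S>\<close>-module \<open>M\<close> over \<open>'k\<close> is given by a presentation: homogeneous generators with an
  arity \<open>n\<close> and a homological degree \<open>d\<close>, and homogeneous relations; \<open>M(n)\<^sub>d\<close> is the span of the
  generators of arity \<open>n\<close> and degree \<open>d\<close> modulo the span of the relations.  (Every
  dg \<open>\<S>\<close>-module has such a presentation.)  The right action of the
  permutations \<open>\<sigma>\<close> of \<open>{..<n}\<close> and the differential are given on generators.  The generators being
  homogeneous, tensor products and the composition product are again presented
  by generators and relations.

  The inputs of an operation are numbered from \<open>0\<close>, and the action is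
  \<open>(\<mu>\<cdot>\<sigma>)(x\<^sub>0, x\<^sub>1, \<dots>) = \<mu>(x\<^bsub>\<sigma>\<inverse>(0)\<^esub>, x\<^bsub>\<sigma>\<inverse>(1)\<^esub>, \<dots>)\<close>.
\<close>

record (overloaded) ('g, 'k) smod =
  gens :: "'g set"
  arity :: "'g \<Rightarrow> nat"
  deg :: "'g \<Rightarrow> int"
  act :: "(nat \<Rightarrow> nat) \<Rightarrow> 'g \<Rightarrow> 'g \<Rightarrow>\<^sub>0 'k"
  dif :: "'g \<Rightarrow> 'g \<Rightarrow>\<^sub>0 'k"
  rels :: "('g \<Rightarrow>\<^sub>0 'k) set"

definition null :: "('g, 'k::field, 'z) smod_scheme \<Rightarrow> ('g \<Rightarrow>\<^sub>0 'k) set"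
  where "null M = lspan (rels M)"

definition vectors :: "('g, 'k::field, 'z) smod_scheme \<Rightarrow> nat \<Rightarrow> int \<Rightarrow> ('g \<Rightarrow>\<^sub>0 'k) set" where
  "vectors M n d = {x. \<forall>g\<in>Poly_Mapping.keys x. g \<in> gens M \<and> arity M g = n \<and> deg M g = d}"

definition unit_smod :: "(unit, 'k::field) smod" where
  "unit_smod = \<lparr>gens = UNIV, arity = (\<lambda>_. 1), deg = (\<lambda>_. 0), act = (\<lambda>_ g. gen g),
                dif = (\<lambda>_. 0), rels = {}\<rparr>"

definition dsum ::
  "('g, 'k::field, 'y) smod_scheme \<Rightarrow> ('h, 'k, 'z) smod_scheme \<Rightarrow> ('g + 'h, 'k) smod" where
  "dsum M N =
    \<lparr>gens = gens M <+> gens N,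
     arity = case_sum (arity M) (arity N),
     deg = case_sum (deg M) (deg N),
     act = (\<lambda>\<sigma>. case_sum (\<lambda>g. lin (\<lambda>x. gen (Inl x)) (act M \<sigma> g)) (\<lambda>h. lin (\<lambda>x. gen (Inr x)) (act N \<sigma> h))),
     dif = case_sum (\<lambda>g. lin (\<lambda>x. gen (Inl x)) (dif M g)) (\<lambda>h. lin (\<lambda>x. gen (Inr x)) (dif N h)),
     rels = lin (\<lambda>x. gen (Inl x)) ` rels M \<union> lin (\<lambda>x. gen (Inr x)) ` rels N\<rparr>"


section \<open>The composition product\<close>

text \<open>
  A generator \<open>(\<mu>, [(\<nu>\<^sub>1, L\<^sub>1), \<dots>, (\<nu>\<^sub>k, L\<^sub>k)])\<close> of \<open>(M \<circ> N)(n)\<close> is the two-level tree with root \<open>\<mu>\<close>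
  and the \<open>\<nu>\<^sub>i\<close> grafted on its \<open>k\<close> inputs, where the \<open>j\<close>-th input of \<open>\<nu>\<^sub>i\<close> carries the label \<open>L\<^sub>i ! j\<close>; the
  labels are \<open>0, \<dots>, n - 1\<close>, each used once.  This encodes
  \<open>M(k) \<otimes>\<^bsub>\<S>\<^sub>k\<^esub> Ind(N(i\<^sub>1) \<otimes> \<dots> \<otimes> N(i\<^sub>k))\<close>: the last two families of relations take the coinvariants
  under \<open>\<S>\<^sub>k\<close> (with Koszul signs) and under \<open>\<S>\<^bsub>i\<^sub>1\<^esub> \<times> \<dots> \<times> \<S>\<^bsub>i\<^sub>k\<^esub>\<close>, and the first two are the relations of
  \<open>M\<close> and of \<open>N\<close>.
\<close>

type_synonym ('g, 'h) two_level = "'g \<times> ('h \<times> nat list) list"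

definition permute_list_by :: "(nat \<Rightarrow> nat) \<Rightarrow> 'a list \<Rightarrow> 'a list"
  where "permute_list_by \<sigma> xs = map (\<lambda>i. xs ! inv \<sigma> i) [0..<length xs]"

definition labels :: "('g, 'h) two_level \<Rightarrow> nat list"
  where "labels x = concat (map snd (snd x))"

definition scomp_gens ::
  "('g, 'k::field, 'y) smod_scheme \<Rightarrow> ('h, 'k, 'z) smod_scheme \<Rightarrow> ('g, 'h) two_level set" where
  "scomp_gens M N =
    {(g, hs). g \<in> gens M \<and> length hs = arity M g \<and>
       (\<forall>(h, L)\<in>set hs. h \<in> gens N \<and> length L = arity N h) \<and>
       distinct (labels (g, hs)) \<and> set (labels (g, hs)) = {..<length (labels (g, hs))}}"

definition scomp_rels ::
  "('g, 'k::field, 'y) smod_scheme \<Rightarrow> ('h, 'k, 'z) smod_scheme \<Rightarrow> (('g, 'h) two_level \<Rightarrow>\<^sub>0 'k) set" where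
  "scomp_rels M N = {r. Poly_Mapping.keys r \<subseteq> scomp_gens M N} \<inter>
    ({lin (\<lambda>g. gen (g, hs)) r |r hs. r \<in> rels M} \<union>
     {lin (\<lambda>h. gen (g, xs @ (h, L) # ys)) r |g xs r L ys. r \<in> rels N} \<union>
     {lin (\<lambda>g'. gen (g', hs)) (act M \<sigma> g)
        - smul (reorder_sign (map (\<lambda>(h, L). deg N h) hs) (map (inv \<sigma>) [0..<length hs]))
               (gen (g, permute_list_by \<sigma> hs)) |g hs \<sigma>.
        g \<in> gens M \<and> length hs = arity M g \<and> \<sigma> permutes {..<arity M g}} \<union>
     {lin (\<lambda>h'. gen (g, xs @ (h', L) # ys)) (act N \<sigma> h)
        - gen (g, xs @ (h, permute_list_by \<sigma> L) # ys) |g xs h L ys \<sigma>.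
        h \<in> gens N \<and> length L = arity N h \<and> \<sigma> permutes {..<arity N h}})"

definition scomp ::
  "('g, 'k::field, 'y) smod_scheme \<Rightarrow> ('h, 'k, 'z) smod_scheme \<Rightarrow> (('g, 'h) two_level, 'k) smod" where
  "scomp M N =
    \<lparr>gens = scomp_gens M N,
     arity = (\<lambda>x. length (labels x)),
     deg = (\<lambda>(g, hs). deg M g + (\<Sum>(h, L)\<leftarrow>hs. deg N h)),
     act = (\<lambda>\<sigma> (g, hs). gen (g, map (apsnd (map (inv \<sigma>))) hs)),
     dif = (\<lambda>(g, hs). lin (\<lambda>g'. gen (g', hs)) (dif M g)
       + (\<Sum>i<length hs. smul (ksgn (deg M g + (\<Sum>(h, L)\<leftarrow>take i hs. deg N h)))
            (lin (\<lambda>h'. gen (g, hs[i := (h', snd (hs ! i))])) (dif N (fst (hs ! i)))))),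
     rels = scomp_rels M N\<rparr>"

text \<open>\<open>M \<circ> (N, N')\<close>: the summand of \<open>M \<circ> (N \<oplus> N')\<close> with exactly one factor in \<open>N'\<close>.\<close>

definition linear_gens :: "('g, 'h + 'l) two_level set" where
  "linear_gens = {(g, hs). length (filter (\<lambda>(a, L). \<not> isl a) hs) = 1}"

definition scomp_lin ::
  "('g, 'k::field, 'x) smod_scheme \<Rightarrow> ('h, 'k, 'y) smod_scheme \<Rightarrow> ('l, 'k, 'z) smod_scheme \<Rightarrow>
   (('g, 'h + 'l) two_level, 'k) smod" where
  "scomp_lin M N N' = (scomp M (dsum N N'))
    \<lparr>gens := gens (scomp M (dsum N N')) \<inter> linear_gens,
     rels := {r \<in> rels (scomp M (dsum N N')). Poly_Mapping.keys r \<subseteq> linear_gens}\<rparr>"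

text \<open>\<open>M \<circ>\<^sub>(\<^sub>1\<^sub>) N = M \<circ> (I, N)\<close>.\<close>

abbreviation scomp1 where "scomp1 M N \<equiv> scomp_lin M unit_smod N"

type_synonym ('g, 'h) inf_two_level = "('g, unit + 'h) two_level"


subsection \<open>Functoriality and associativity\<close>

text \<open>\<open>f \<circ> id\<close>, and \<open>id \<circ> f\<close> for \<open>f\<close> of degree \<open>0\<close>.\<close>

definition comp_left ::
  "('g \<Rightarrow> 'g' \<Rightarrow>\<^sub>0 'k::field) \<Rightarrow> ('g, 'h) two_level \<Rightarrow> ('g', 'h) two_level \<Rightarrow>\<^sub>0 'k" where
  "comp_left f = (\<lambda>(g, hs). lin (\<lambda>g'. gen (g', hs)) (f g))"

definition comp_right ::
  "('h \<Rightarrow> 'h' \<Rightarrow>\<^sub>0 'k::field) \<Rightarrow> ('g, 'h) two_level \<Rightarrow> ('g, 'h') two_level \<Rightarrow>\<^sub>0 'k" where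
  "comp_right f = (\<lambda>(g, hs). lin (\<lambda>hs'. gen (g, hs')) (tensor (map (\<lambda>(h, L). lin (\<lambda>h'. gen (h', L)) (f h)) hs)))"

text \<open>
  \<open>id \<circ>\<^sub>(\<^sub>1\<^sub>) f\<close> on \<open>M \<circ>\<^sub>(\<^sub>1\<^sub>) N\<close> for \<open>f\<close> of degree \<open>e\<close>: the sign comes from moving \<open>f\<close> past the root, the
  other factors being in \<open>I\<close>.
\<close>

definition comp1_right ::
  "('g, 'k::field, 'z) smod_scheme \<Rightarrow> int \<Rightarrow> ('h \<Rightarrow> 'h' \<Rightarrow>\<^sub>0 'k) \<Rightarrow>
   ('g, 'h) inf_two_level \<Rightarrow> ('g, 'h') inf_two_level \<Rightarrow>\<^sub>0 'k" where
  "comp1_right M e f = (\<lambda>(g, hs).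
     \<Sum>i<length hs. case fst (hs ! i) of
         Inl _ \<Rightarrow> 0
       | Inr h \<Rightarrow> smul (ksgn (e * deg M g))
                      (lin (\<lambda>h'. gen (g, map (apfst (map_sum id (\<lambda>_. h'))) hs)) (f h)))"

text \<open>\<open>id \<circ>' id : M \<circ> N \<rightarrow> M \<circ> (N, N)\<close>.\<close>

definition inf_id :: "('g, 'h) two_level \<Rightarrow> ('g, 'h + 'h) two_level \<Rightarrow>\<^sub>0 'k::field" where
  "inf_id = (\<lambda>(g, hs). \<Sum>j<length hs.
     gen (g, map (\<lambda>i. ((if i = j then Inr else Inl) (fst (hs ! i)), snd (hs ! i))) [0..<length hs]))"

text \<open>Consecutive labels for a list of elements with prescribed arities.\<close>

fun consecutive :: "nat \<Rightarrow> ('h \<times> nat) list \<Rightarrow> ('h \<times> nat list) list" where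
  "consecutive k [] = []"
| "consecutive k ((h, n) # hs) = (h, [k..<k + n]) # consecutive (k + n) hs"

text \<open>
  The associativity isomorphism \<open>(M \<circ> N) \<circ> R \<rightarrow> M \<circ> (N \<circ> R)\<close>: the element of \<open>R\<close> that
  carries the label of an input of a factor in \<open>N\<close> is moved onto that input.
\<close>

definition assoc ::
  "('h, 'k::field, 'y) smod_scheme \<Rightarrow> ('l, 'k, 'z) smod_scheme \<Rightarrow>
   (('g, 'h) two_level, 'l) two_level \<Rightarrow> ('g, ('h, 'l) two_level) two_level \<Rightarrow>\<^sub>0 'k" where
  "assoc N R = (\<lambda>((g, hs), rs).
     smul (reorder_sign (map (\<lambda>(h, L). deg N h) hs @ map (\<lambda>(r, K). deg R r) rs)
             (concat (map (\<lambda>i. i # map ((+) (length hs)) (snd (hs ! i))) [0..<length hs])))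
       (gen (g, map (\<lambda>(h, L). ((h, consecutive 0 (map (\<lambda>l. apsnd length (rs ! l)) L)),
                              concat (map (\<lambda>l. snd (rs ! l)) L))) hs)))"

text \<open>\<open>I \<circ> M \<cong> M\<close>: the label list \<open>L\<close> on \<open>\<mu>\<close> is the permutation \<open>\<sigma>\<inverse>\<close> for which \<open>(\<mu>, L) = \<mu>\<cdot>\<sigma>\<close>.\<close>

definition relabelling :: "nat list \<Rightarrow> nat \<Rightarrow> nat"
  where "relabelling L = inv (\<lambda>i. if i < length L then L ! i else i)"

definition left_unitor ::
  "('g, 'k::field, 'z) smod_scheme \<Rightarrow> (unit, 'g) two_level \<Rightarrow> 'g \<Rightarrow>\<^sub>0 'k" where
  "left_unitor M = (\<lambda>(_, gs). case gs of [(g, L)] \<Rightarrow> act M (relabelling L) g | _ \<Rightarrow> 0)"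


section \<open>Augmented operads and coaugmented cooperads\<close>

text \<open>
  The data of an augmented operad \<open>P = I \<oplus> P\<^sup>+\<close>, with \<open>P\<^sup>+\<close> the augmentation ideal: the presentation is
  adapted to this splitting, that is, one generator \<open>id_op P\<close> spans \<open>I\<close> and the
  others (with all relations) present \<open>P\<^sup>+\<close>.  Hence the augmentation is \<open>1\<close> on \<open>id_op P\<close> and \<open>0\<close> on the
  other generators.  \<open>gamma P\<close> is the composition \<open>P \<circ> P \<rightarrow> P\<close>.
\<close>

record (overloaded) ('g, 'k) operad = "('g, 'k) smod" +
  gamma :: "('g, 'g) two_level \<Rightarrow> 'g \<Rightarrow>\<^sub>0 'k"
  id_op :: 'g

definition aug :: "('g, 'k::field, 'z) operad_scheme \<Rightarrow> 'g \<Rightarrow> 'k"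
  where "aug P p = (if p = id_op P then 1 else 0)"

text \<open>The operad of non-unital commutative algebras: \<open>n\<close> is the generator of \<open>Com(n) = \<K>\<close>.\<close>

definition Com :: "(nat, 'k::field) operad" where
  "Com = \<lparr>gens = {1..}, arity = id, deg = (\<lambda>_. 0), act = (\<lambda>_ n. gen n), dif = (\<lambda>_. 0), rels = {},
          gamma = (\<lambda>x. gen (length (labels x))), id_op = 1\<rparr>"

text \<open>\<open>copr C\<close> is the decomposition \<open>\<Delta> : C \<rightarrow> C \<circ> C\<close>.\<close>

record (overloaded) ('c, 'k) cooperad = "('c, 'k) smod" +
  copr :: "'c \<Rightarrow> ('c, 'c) two_level \<Rightarrow>\<^sub>0 'k"
  counit :: "'c \<Rightarrow> 'k"

text \<open>\<open>\<Delta>\<^sub>p : C \<rightarrow> C \<circ> C \<rightarrow> C \<circ> (C, C) \<rightarrow> C \<circ> (I, C)\<close>, the last map being the counit on the first kind of factors.\<close>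

definition partial_copr ::
  "('c, 'k::field, 'z) cooperad_scheme \<Rightarrow> 'c \<Rightarrow> ('c, 'c) inf_two_level \<Rightarrow>\<^sub>0 'k" where
  "partial_copr C c =
     lin (comp_right (case_sum (\<lambda>u. smul (counit C u) (gen (Inl ()))) (\<lambda>u. gen (Inr u))))
       (lin inf_id (copr C c))"


subsection \<open>Free left modules\<close>

text \<open>
  \<open>eta_at P Y : Y \<cong> I \<circ> Y \<rightarrow> P \<circ> Y\<close>, and \<open>gamma_at P Y : P \<circ> (P \<circ> Y) \<cong> (P \<circ> P) \<circ> Y \<rightarrow> P \<circ> Y\<close>.
  For \<open>f : X \<rightarrow> P \<circ> Y\<close> of degree \<open>0\<close>, \<open>extend P Y f : P \<circ> X \<rightarrow> P \<circ> Y\<close> is \<open>gamma_at \<circ> (id \<circ> f)\<close>.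
\<close>

definition eta_at ::
  "('p, 'k::field, 'x) operad_scheme \<Rightarrow> ('y, 'k, 'z) smod_scheme \<Rightarrow> 'y \<Rightarrow> ('p, 'y) two_level \<Rightarrow>\<^sub>0 'k" where
  "eta_at P Y y = gen (id_op P, [(y, [0..<arity Y y])])"

definition gamma_at ::
  "('p, 'k::field, 'x) operad_scheme \<Rightarrow> ('y, 'k, 'z) smod_scheme \<Rightarrow>
   ('p, ('p, 'y) two_level) two_level \<Rightarrow> ('p, 'y) two_level \<Rightarrow>\<^sub>0 'k" where
  "gamma_at P Y = (\<lambda>(p, zs).
     smul (unshuffle_sign (map (\<lambda>((q, ys), K). (deg P q, \<Sum>(y, L)\<leftarrow>ys. deg Y y)) zs))
       (lin (\<lambda>p'. gen (p', concat (map (\<lambda>((q, ys), K). map (apsnd (map ((!) K))) ys) zs)))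
         (gamma P (p, consecutive 0 (map (\<lambda>((q, ys), K). (q, length ys)) zs)))))"

definition extend ::
  "('p, 'k::field, 'x) operad_scheme \<Rightarrow> ('y, 'k, 'z) smod_scheme \<Rightarrow> ('a \<Rightarrow> ('p, 'y) two_level \<Rightarrow>\<^sub>0 'k) \<Rightarrow>
   ('p, 'a) two_level \<Rightarrow> ('p, 'y) two_level \<Rightarrow>\<^sub>0 'k" where
  "extend P Y f x = lin (gamma_at P Y) (comp_right f x)"


section \<open>The bar construction\<close>

text \<open>
  \<open>B(P) = F\<^sup>c(sP\<^sup>+)\<close> is presented by planar trees with vertices labelled by the generators of \<open>P\<^sup>+\<close> and
  leaves labelled by \<open>0, \<dots>, n - 1\<close>.  A vertex \<open>p\<close> stands for \<open>s p\<close>, of degree \<open>\<bar>p\<bar> + 1\<close>, and a tree for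
  the tensor of its vertices read in prefix order.  \<open>Leaf 0\<close> is the trivial tree, spanning \<open>I\<close>.
\<close>

datatype 'g tree = Leaf nat | Node 'g "'g tree list"

primrec leaves :: "'g tree \<Rightarrow> nat list" where
  "leaves (Leaf l) = [l]"
| "leaves (Node g ts) = concat (map leaves ts)"

primrec relabel :: "(nat \<Rightarrow> nat) \<Rightarrow> 'g tree \<Rightarrow> 'g tree" where
  "relabel f (Leaf l) = Leaf (f l)"
| "relabel f (Node g ts) = Node g (map (relabel f) ts)"

primrec tree_deg :: "('g, 'k, 'z) smod_scheme \<Rightarrow> 'g tree \<Rightarrow> int" where
  "tree_deg P (Leaf l) = 0"
| "tree_deg P (Node g ts) = deg P g + 1 + sum_list (map (tree_deg P) ts)"

primrec tree_ok :: "('g, 'k, 'z) operad_scheme \<Rightarrow> 'g tree \<Rightarrow> bool" where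
  "tree_ok P (Leaf l) = True"
| "tree_ok P (Node g ts) = (g \<in> gens P \<and> g \<noteq> id_op P \<and> length ts = arity P g \<and> list_all (tree_ok P) ts)"

definition bar_gens :: "('g, 'k, 'z) operad_scheme \<Rightarrow> 'g tree set" where
  "bar_gens P = {t. tree_ok P t \<and> distinct (leaves t) \<and> set (leaves t) = {..<length (leaves t)}}"

text \<open>Relations of \<open>P\<^sup>+\<close> and equivariance at one vertex, inside an arbitrary tree.\<close>

inductive_set tree_rels :: "('g, 'k::field, 'z) operad_scheme \<Rightarrow> ('g tree \<Rightarrow>\<^sub>0 'k) set"
  for P :: "('g, 'k::field, 'z) operad_scheme" where
  vertex: "r \<in> rels P \<Longrightarrow> lin (\<lambda>g. gen (Node g ts)) r \<in> tree_rels P"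
| equivariance: "g \<in> gens P \<Longrightarrow> length ts = arity P g \<Longrightarrow> \<sigma> permutes {..<arity P g} \<Longrightarrow>
    lin (\<lambda>g'. gen (Node g' ts)) (act P \<sigma> g)
      - smul (reorder_sign (map (tree_deg P) ts) (map (inv \<sigma>) [0..<length ts]))
             (gen (Node g (permute_list_by \<sigma> ts))) \<in> tree_rels P"
| inside: "r \<in> tree_rels P \<Longrightarrow> lin (\<lambda>t. gen (Node g (xs @ t # ys))) r \<in> tree_rels P"

text \<open>
  The differential is induced by \<open>s p \<mapsto> - s (d p)\<close> on vertices and by the contraction
  \<open>s p \<otimes> s q \<mapsto> (-1)\<^bsup>\<bar>p\<bar>\<^esup> s (p \<circ>\<^sub>i q)\<close> of inner edges.
\<close>

definition partial_comp :: "('g, 'k::field, 'z) operad_scheme \<Rightarrow> 'g \<Rightarrow> nat \<Rightarrow> 'g \<Rightarrow> 'g \<Rightarrow>\<^sub>0 'k" where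
  "partial_comp P p i q =
     gamma P (p, consecutive 0 ((replicate (arity P p) (id_op P, 1))[i := (q, arity P q)]))"

primrec bar_dif :: "('g, 'k::field, 'z) operad_scheme \<Rightarrow> 'g tree \<Rightarrow> 'g tree \<Rightarrow>\<^sub>0 'k" where
  "bar_dif P (Leaf l) = 0"
| "bar_dif P (Node g ts) =
     - lin (\<lambda>g'. gen (Node g' ts)) (dif P g)
     + (\<Sum>i<length ts. case ts ! i of
           Leaf l \<Rightarrow> 0
         | Node h us \<Rightarrow>
             smul (ksgn (deg P g + (deg P h + 1) * sum_list (map (tree_deg P) (take i ts))))
               (lin (\<lambda>g'. gen (Node g' (take i ts @ us @ drop (Suc i) ts))) (partial_comp P g i h)))
     + (\<Sum>i<length ts.
           smul (ksgn (deg P g + 1 + sum_list (map (tree_deg P) (take i ts))))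
             (lin (\<lambda>t. gen (Node g (ts[i := t]))) (map (bar_dif P) ts ! i)))"

text \<open>
  The decomposition of the cofree cooperad cuts a tree into a lower tree and upper trees in all
  possible ways.  \<open>cuts\<close> lists the triples of a sign, a lower tree (leaves not yet
  labelled) and the upper trees in planar order.
\<close>

fun cuts :: "('g, 'k::field, 'z) operad_scheme \<Rightarrow> 'g tree \<Rightarrow> ('k \<times> 'g tree \<times> 'g tree list) list" where
  "cuts P (Leaf l) = [(1, Leaf 0, [Leaf l])]"
| "cuts P (Node g ts) = (1, Leaf 0, [Node g ts]) #
     map (\<lambda>cs. (prod_list (map fst cs) *
                  unshuffle_sign (map (\<lambda>(_, lo, ups). (tree_deg P lo, sum_list (map (tree_deg P) ups))) cs),
                Node g (map (fst \<circ> snd) cs), concat (map (snd \<circ> snd) cs)))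
       (product_lists (map (cuts P) ts))"

fun number_leaves :: "nat \<Rightarrow> 'g tree \<Rightarrow> 'g tree" and number_leaves_list :: "nat \<Rightarrow> 'g tree list \<Rightarrow> 'g tree list" where
  "number_leaves k (Leaf l) = Leaf k"
| "number_leaves k (Node g ts) = Node g (number_leaves_list k ts)"
| "number_leaves_list k [] = []"
| "number_leaves_list k (t # ts) = number_leaves k t # number_leaves_list (k + length (leaves t)) ts"

definition bar :: "('g, 'k::field, 'z) operad_scheme \<Rightarrow> ('g tree, 'k) cooperad" where
  "bar P =
    \<lparr>gens = bar_gens P,
     arity = (\<lambda>t. length (leaves t)),
     deg = tree_deg P,
     act = (\<lambda>\<sigma> t. gen (relabel (inv \<sigma>) t)),
     dif = bar_dif P,
     rels = {r \<in> tree_rels P. Poly_Mapping.keys r \<subseteq> bar_gens P},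
     copr = (\<lambda>t. \<Sum>(s, lo, ups)\<leftarrow>cuts P t.
        smul s (gen (number_leaves 0 lo, map (\<lambda>u. (number_leaves 0 u, leaves u)) ups))),
     counit = (\<lambda>t. case t of Leaf _ \<Rightarrow> 1 | Node _ _ \<Rightarrow> 0)\<rparr>"

text \<open>The twisting morphism \<open>\<pi> : B(P) \<rightarrow> sP\<^sup>+ \<rightarrow> P\<^sup>+ \<rightarrow> P\<close>.\<close>

definition bar_proj :: "('g, 'k::field, 'z) operad_scheme \<Rightarrow> 'g tree \<Rightarrow> 'g \<Rightarrow>\<^sub>0 'k" where
  "bar_proj P t = (case t of
       Leaf _ \<Rightarrow> 0
     | Node g ts \<Rightarrow> if \<forall>u\<in>set ts. \<exists>l. u = Leaf l then act P (relabelling (leaves t)) g else 0)"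


section \<open>The infinitesimal bimodules \<open>L\<^sub>P\<close> and \<open>\<Omega>\<^sub>P\<close>\<close>

text \<open>
  For \<open>\<rho> : N \<circ> P \<rightarrow> R\<close>, the map
  \<open>(I \<oplus> N) \<circ> P \<cong> P \<oplus> (N \<circ> P) \<rightarrow> P \<circ> (I \<oplus> R)\<close>.  The extension to \<open>P \<circ> ((I \<oplus> N) \<circ> P)\<close> composes in \<open>P\<close> the root with the
  factors \<open>P\<close> that are not attached to \<open>N\<close>.
\<close>

definition absorb ::
  "('p, 'k::field, 'x) operad_scheme \<Rightarrow> ('r, 'k, 'y) smod_scheme \<Rightarrow> (('n, 'p) two_level \<Rightarrow> 'r \<Rightarrow>\<^sub>0 'k) \<Rightarrow>
   (unit + 'n, 'p) two_level \<Rightarrow> ('p, 'r) inf_two_level \<Rightarrow>\<^sub>0 'k" where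
  "absorb P R \<rho> = (\<lambda>(a, qs). case a of
       Inl _ \<Rightarrow> (case qs of [(q, L)] \<Rightarrow> gen (q, map (\<lambda>l. (Inl (), [l])) L) | _ \<Rightarrow> 0)
     | Inr n \<Rightarrow> lin (eta_at P (dsum unit_smod R)) (lin (\<lambda>r. gen (Inr r)) (\<rho> (n, qs))))"

text \<open>The right action \<open>(P \<circ>\<^sub>(\<^sub>1\<^sub>) R) \<circ> P \<rightarrow> P \<circ>\<^sub>(\<^sub>1\<^sub>) R\<close> for a right \<open>P\<close>-module \<open>(R, \<rho>)\<close>.\<close>

definition right_action ::
  "('p, 'k::field, 'x) operad_scheme \<Rightarrow> ('r, 'k, 'y) smod_scheme \<Rightarrow> (('r, 'p) two_level \<Rightarrow> 'r \<Rightarrow>\<^sub>0 'k) \<Rightarrow>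
   (('p, 'r) inf_two_level, 'p) two_level \<Rightarrow> ('p, 'r) inf_two_level \<Rightarrow>\<^sub>0 'k" where
  "right_action P R \<rho> y =
     lin (extend P (dsum unit_smod R) (absorb P R \<rho>)) (assoc (dsum unit_smod R) P y)"

text \<open>The left action \<open>P \<circ>\<^sub>(\<^sub>1\<^sub>) (P \<circ>\<^sub>(\<^sub>1\<^sub>) R) \<rightarrow> P \<circ>\<^sub>(\<^sub>1\<^sub>) R\<close>.\<close>

definition left_action ::
  "('p, 'k::field, 'x) operad_scheme \<Rightarrow> ('r, 'k, 'y) smod_scheme \<Rightarrow>
   ('p, ('p, 'r) inf_two_level) inf_two_level \<Rightarrow> ('p, 'r) inf_two_level \<Rightarrow>\<^sub>0 'k" where
  "left_action P R =
     extend P (dsum unit_smod R) (case_sum (\<lambda>_. eta_at P (dsum unit_smod R) (Inl ())) gen)"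


subsection \<open>The cotangent complex\<close>

type_synonym ('p, 'c) cot = "('p, ('c, 'p) two_level) inf_two_level"

text \<open>
  \<open>twist_left\<close> is \<open>C \<circ> P \<rightarrow> (P \<circ>\<^sub>(\<^sub>1\<^sub>) C) \<circ> P \<rightarrow> P \<circ>\<^sub>(\<^sub>1\<^sub>) (C \<circ> P)\<close>, the first map being \<open>(\<alpha> \<circ>\<^sub>(\<^sub>1\<^sub>) id) \<Delta>\<^sub>p\<close>, and
  \<open>twist_right\<close> is \<open>C \<circ> P \<rightarrow> (C \<circ>\<^sub>(\<^sub>1\<^sub>) P) \<circ> P \<rightarrow> C \<circ> P\<close>, the first map being \<open>(id \<circ>\<^sub>(\<^sub>1\<^sub>) \<alpha>) \<Delta>\<^sub>p\<close>.
\<close>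

definition twist_left ::
  "('p, 'k::field, 'x) operad_scheme \<Rightarrow> ('c, 'k, 'y) cooperad_scheme \<Rightarrow> ('c \<Rightarrow> 'p \<Rightarrow>\<^sub>0 'k) \<Rightarrow>
   ('c, 'p) two_level \<Rightarrow> ('p, 'c) cot \<Rightarrow>\<^sub>0 'k" where
  "twist_left P C \<alpha> = (\<lambda>(c, qs).
     lin (extend P (dsum unit_smod (scomp C P)) (absorb P (scomp C P) gen))
       (lin (assoc (dsum unit_smod C) P)
         (lin (\<lambda>w. gen (w, qs)) (lin (comp_left \<alpha>) (partial_copr C c)))))"

definition twist_right ::
  "('p, 'k::field, 'x) operad_scheme \<Rightarrow> ('c, 'k, 'y) cooperad_scheme \<Rightarrow> ('c \<Rightarrow> 'p \<Rightarrow>\<^sub>0 'k) \<Rightarrow>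
   ('c, 'p) two_level \<Rightarrow> ('c, 'p) two_level \<Rightarrow>\<^sub>0 'k" where
  "twist_right P C \<alpha> = (\<lambda>(c, qs).
     lin (comp_right (\<lambda>(a, rs). case a of
            Inl _ \<Rightarrow> left_unitor P ((), rs)
          | Inr p \<Rightarrow> gamma P (p, rs)))
       (lin (assoc (dsum unit_smod P) P)
         (lin (\<lambda>w. gen (w, qs)) (lin (comp1_right C (- 1) \<alpha>) (partial_copr C c)))))"

definition delta_left ::
  "('p, 'k::field, 'x) operad_scheme \<Rightarrow> ('c, 'k, 'y) cooperad_scheme \<Rightarrow> ('c \<Rightarrow> 'p \<Rightarrow>\<^sub>0 'k) \<Rightarrow>
   ('p, 'c) cot \<Rightarrow> ('p, 'c) cot \<Rightarrow>\<^sub>0 'k" where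
  "delta_left P C \<alpha> x = lin (left_action P (scomp C P)) (comp1_right P (- 1) (twist_left P C \<alpha>) x)"

definition delta_right ::
  "('p, 'k::field, 'x) operad_scheme \<Rightarrow> ('c, 'k, 'y) cooperad_scheme \<Rightarrow> ('c \<Rightarrow> 'p \<Rightarrow>\<^sub>0 'k) \<Rightarrow>
   ('p, 'c) cot \<Rightarrow> ('p, 'c) cot \<Rightarrow>\<^sub>0 'k" where
  "delta_right P C \<alpha> = comp1_right P (- 1) (twist_right P C \<alpha>)"

definition cotangent ::
  "('p, 'k::field, 'x) operad_scheme \<Rightarrow> ('c, 'k, 'y) cooperad_scheme \<Rightarrow> ('c \<Rightarrow> 'p \<Rightarrow>\<^sub>0 'k) \<Rightarrow>
   (('p, 'c) cot, 'k) smod" where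
  "cotangent P C \<alpha> = (scomp1 P (scomp C P))
    \<lparr>dif := (\<lambda>x. dif (scomp1 P (scomp C P)) x - delta_left P C \<alpha> x + delta_right P C \<alpha> x)\<rparr>"

definition cotangent_action ::
  "('p, 'k::field, 'x) operad_scheme \<Rightarrow> ('c, 'k, 'y) cooperad_scheme \<Rightarrow>
   (('p, 'c) cot, 'p) two_level \<Rightarrow> ('p, 'c) cot \<Rightarrow>\<^sub>0 'k" where
  "cotangent_action P C =
     right_action P (scomp C P) (\<lambda>y. lin (comp_right (gamma P)) (assoc P P y))"


subsection \<open>Kaehler differentials\<close>

definition c2 ::
  "('p, 'k::field, 'z) operad_scheme \<Rightarrow>
   ('p, ('p, 'p) two_level) inf_two_level \<Rightarrow> ('p, 'p) inf_two_level \<Rightarrow>\<^sub>0 'k" where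
  "c2 P x =
     (let IP = dsum unit_smod P;
          inner = extend P IP (case_sum (\<lambda>r. gen (r, map (\<lambda>l. (Inl (), [l])) [0..<arity P r]))
                                        (\<lambda>r. eta_at P IP (Inr r)))
      in lin (left_action P P) (comp1_right P 0 (\<lambda>y. lin inner (inf_id y)) x))"

text \<open>
  The images of \<open>id \<circ>\<^sub>(\<^sub>1\<^sub>) \<gamma> - c\<^sub>2\<close> form a sub-bimodule, so the coequalizer of infinitesimal bimodules is
  the quotient of dg \<open>\<S>\<close>-modules by these images.
\<close>

definition kaehler :: "('p, 'k::field, 'z) operad_scheme \<Rightarrow> (('p, 'p) inf_two_level, 'k) smod" where
  "kaehler P = (scomp1 P P)
    \<lparr>rels := rels (scomp1 P P) \<union>
       {comp1_right P 0 (gamma P) x - c2 P x |x. x \<in> gens (scomp1 P (scomp P P))}\<rparr>"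

definition kaehler_action ::
  "('p, 'k::field, 'z) operad_scheme \<Rightarrow>
   (('p, 'p) inf_two_level, 'p) two_level \<Rightarrow> ('p, 'p) inf_two_level \<Rightarrow>\<^sub>0 'k" where
  "kaehler_action P = right_action P P (gamma P)"

text \<open>The map \<open>L\<^sub>P \<rightarrow> P \<circ>\<^sub>(\<^sub>1\<^sub>) P \<rightarrow> \<Omega>\<^sub>P\<close> induced by the counit of \<open>C\<close>.\<close>

definition cotangent_to_kaehler ::
  "('p, 'k::field, 'x) operad_scheme \<Rightarrow> ('c, 'k, 'y) cooperad_scheme \<Rightarrow>
   ('p, 'c) cot \<Rightarrow> ('p, 'p) inf_two_level \<Rightarrow>\<^sub>0 'k" where
  "cotangent_to_kaehler P C =
     comp1_right P 0
       (\<lambda>z. lin (left_unitor P) (comp_left (\<lambda>c. smul (counit C c) (gen ())) z))"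


section \<open>Relative composition product\<close>

text \<open>
  \<open>M \<circ>\<^sub>P N\<close> for a right module \<open>(M, \<rho>)\<close> and a left module \<open>(N, \<lambda>)\<close>: the coequalizer of
  \<open>\<rho> \<circ> id\<close> and \<open>id \<circ> \<lambda>\<close> on \<open>M \<circ> P \<circ> N\<close>.
\<close>

definition rel_comp ::
  "('m, 'k::field, 'x) smod_scheme \<Rightarrow> (('m, 'p) two_level \<Rightarrow> 'm \<Rightarrow>\<^sub>0 'k) \<Rightarrow>
   ('p, 'k, 'y) operad_scheme \<Rightarrow>
   ('n, 'k, 'z) smod_scheme \<Rightarrow> (('p, 'n) two_level \<Rightarrow> 'n \<Rightarrow>\<^sub>0 'k) \<Rightarrow> (('m, 'n) two_level, 'k) smod" where
  "rel_comp M \<rho> P N lam = (scomp M N)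
    \<lparr>rels := rels (scomp M N) \<union>
       {comp_left \<rho> y - lin (comp_right lam) (assoc P N y) |y. y \<in> gens (scomp (scomp M P) N)}\<rparr>"

text \<open>The left \<open>P\<close>-module structure \<open>P \<circ> I \<rightarrow> I\<close> given by the augmentation.\<close>

definition unit_action :: "('p, 'k::field, 'z) operad_scheme \<Rightarrow> ('p, unit) two_level \<Rightarrow> unit \<Rightarrow>\<^sub>0 'k" where
  "unit_action P = (\<lambda>(p, _). smul (aug P p) (gen ()))"

definition cotangent_bar ::
  "('p, 'k::field, 'x) operad_scheme \<Rightarrow> ('c, 'k, 'y) cooperad_scheme \<Rightarrow> ('c \<Rightarrow> 'p \<Rightarrow>\<^sub>0 'k) \<Rightarrow>
   ((('p, 'c) cot, unit) two_level, 'k) smod" where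
  "cotangent_bar P C \<alpha> = rel_comp (cotangent P C \<alpha>) (cotangent_action P C) P unit_smod (unit_action P)"

definition kaehler_bar ::
  "('p, 'k::field, 'z) operad_scheme \<Rightarrow> ((('p, 'p) inf_two_level, unit) two_level, 'k) smod" where
  "kaehler_bar P = rel_comp (kaehler P) (kaehler_action P) P unit_smod (unit_action P)"


section \<open>Kernels, homology and the module of obstructions\<close>

text \<open>
  Sub-objects of presented modules: in arity \<open>n\<close> and degree \<open>d\<close> the vector space
  \<open>carr n d\<close> modulo its elements in \<open>nulls\<close>, with differential \<open>bd\<close>.
\<close>

record 'v dg_family =
  carr :: "nat \<Rightarrow> int \<Rightarrow> 'v set"
  nulls :: "'v set"
  bd :: "'v \<Rightarrow> 'v"

definition kernel ::
  "('g \<Rightarrow> 'h \<Rightarrow>\<^sub>0 'k::field) \<Rightarrow> ('g, 'k, 'y) smod_scheme \<Rightarrow> ('h, 'k, 'z) smod_scheme \<Rightarrow>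
   ('g \<Rightarrow>\<^sub>0 'k) dg_family" where
  "kernel f M N =
    \<lparr>carr = (\<lambda>n d. {x \<in> vectors M n d. lin f x \<in> null N}), nulls = null M, bd = lin (dif M)\<rparr>"

definition cycles :: "'v dg_family \<Rightarrow> nat \<Rightarrow> int \<Rightarrow> 'v set"
  where "cycles X n d = {x \<in> carr X n d. bd X x \<in> nulls X}"

definition boundaries :: "'v::ab_group_add dg_family \<Rightarrow> nat \<Rightarrow> int \<Rightarrow> 'v set"
  where "boundaries X n d = {x \<in> carr X n d. \<exists>y\<in>carr X n (d + 1). x - bd X y \<in> nulls X}"

definition homology :: "'v::ab_group_add dg_family \<Rightarrow> nat \<Rightarrow> int \<Rightarrow> 'v set set" where
  "homology X n d =
     cycles X n d // {(x, y). x \<in> cycles X n d \<and> y \<in> cycles X n d \<and> x - y \<in> boundaries X n d}"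

text \<open>The zero class of \<open>homology X n d\<close> is \<open>boundaries X n d\<close>.\<close>

definition homology_zero :: "'v::ab_group_add dg_family \<Rightarrow> int \<Rightarrow> bool"
  where "homology_zero X d \<longleftrightarrow> (\<forall>n. homology X n d = {boundaries X n d})"

definition acyclic_dg :: "'v::ab_group_add dg_family \<Rightarrow> bool"
  where "acyclic_dg X \<longleftrightarrow> (\<forall>d. homology_zero X d)"

text \<open>\<open>O\<^sub>P\<close> for a Koszul morphism \<open>\<alpha> : C \<rightarrow> P\<close>.\<close>

definition obstruction_kernel ::
  "('p, 'k::field, 'x) operad_scheme \<Rightarrow> ('c, 'k, 'y) cooperad_scheme \<Rightarrow> ('c \<Rightarrow> 'p \<Rightarrow>\<^sub>0 'k) \<Rightarrow>
   ((('p, 'c) cot, unit) two_level \<Rightarrow>\<^sub>0 'k) dg_family" where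
  "obstruction_kernel P C \<alpha> =
     kernel (comp_left (cotangent_to_kaehler P C)) (cotangent_bar P C \<alpha>) (kaehler_bar P)"

text \<open>
  The homotopy class of \<open>O\<^sub>P\<close> does not depend on the Koszul morphism; it is represented here by
  means of \<open>\<pi> : B(P) \<rightarrow> P\<close>.
\<close>

definition obstruction_module ::
  "('p, 'k::field, 'z) operad_scheme \<Rightarrow> ((('p, 'p tree) cot, unit) two_level \<Rightarrow>\<^sub>0 'k) dg_family" where
  "obstruction_module P = obstruction_kernel P (bar P) (bar_proj P)"

end

theory Submission
  imports Defs
begin

text \<open>
  Let \<open>c\<close> stand for elements of the bar construction of \<open>Com\<close>.  In \<open>L \<circ>\<^sub>P I\<close> an operation of arity at least \<open>2\<close> grafted on an
  input is zero.  Hence a generator \<open>\<mu>(x, \<dots>, c, \<dots>)\<close> of the quotient survives only if its root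
  \<open>\<mu>\<close> is the identity or the binary product (a larger root is a product in which two of the inputs other than \<open>c\<close>
  are multiplied first), and only if the inputs of \<open>c\<close> carry identities.  In arity \<open>3\<close> this leaves
    \<^item> in degree \<open>2\<close> the three binary trees \<open>T\<^sub>i\<close> with two vertices, \<open>x\<^sub>i\<close> being attached to the root vertex;
    \<^item> in degree \<open>1\<close> the corolla \<open>c\<^sub>3\<close> with three leaves and the three products \<open>x\<^sub>i \<cdot> c\<^sub>2(x\<^sub>j, x\<^sub>k)\<close>;
    \<^item> nothing in degree \<open>0\<close>.

  The counit vanishes on nontrivial trees, so everything in degrees \<open>1\<close> and \<open>2\<close> lies in the kernel that
  defines the module of obstructions.  The differential is \<open>d T\<^sub>i = c\<^sub>3 - x\<^sub>i \<cdot> c\<^sub>2(x\<^sub>j, x\<^sub>k)\<close>: the inner edge is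
  contracted, or the root vertex is split off.  As degree \<open>0\<close> is zero, every element of degree \<open>1\<close> is a cycle, and the boundaries
  are killed by the functional with value \<open>1\<close> on all four generators.  (Dually: the brackets
  \<open>[x\<^sub>i, [x\<^sub>j, x\<^sub>k]]\<close> in the free Lie algebra satisfy one linear relation, the Jacobi identity.)

  The proof works with presentations, so this functional, \<open>weight\<close>, is defined on all generators,
  decomposable ones included.  It does not look at labels, which makes its invariance under relabelling evident.  It vanishes
  on all relations (\<open>weight_null\<close>; the substantial part is the compatibility with the right action of \<open>Com\<close>,
  \<open>cot_weight_cotangent_action\<close>) and on the differentials of generators of arity \<open>3\<close> and degree \<open>2\<close>
  (\<open>weight_dif_eq_0\<close>), while the corolla \<open>c\<^sub>3\<close> is a cycle (\<open>dif_corolla_cycle\<close>) of weight \<open>1\<close>.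
\<close>

section \<open>Linear maps and functionals on free vector spaces\<close>

abbreviation lkp where "lkp \<equiv> Poly_Mapping.lookup"

lemma smul_simps [simp]:
  "smul 1 x = x" "smul 0 x = 0" "smul c 0 = 0" "smul a (smul b x) = smul (a * b) x"
  by (auto intro!: poly_mapping_eqI simp: mult.assoc)

lemma lookup_lin: "lkp (lin f x) h = (\<Sum>g\<in>Poly_Mapping.keys x. lkp x g * lkp (f g) h)"
  unfolding lin_def by (simp add: lookup_sum)

lemma lookup_lin_superset:
  assumes "finite A" "Poly_Mapping.keys x \<subseteq> A"
  shows "lkp (lin f x) h = (\<Sum>g\<in>A. lkp x g * lkp (f g) h)"
  unfolding lookup_lin using assms by (intro sum.mono_neutral_left) (auto simp: in_keys_iff)

lemma lin_0 [simp]: "lin f 0 = 0"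
  by (simp add: lin_def)

lemma lin_gen [simp]: "lin f (gen g :: _ \<Rightarrow>\<^sub>0 'k::field) = f g"
  by (simp add: lin_def)

lemma lin_add [simp]: "lin f (x + y) = lin f x + lin f y"
proof (rule poly_mapping_eqI)
  fix h
  let ?A = "Poly_Mapping.keys x \<union> Poly_Mapping.keys y"
  show "lkp (lin f (x + y)) h = lkp (lin f x + lin f y) h"
    by (subst lookup_lin_superset[of ?A])
       (auto simp: lookup_add lookup_lin_superset[of ?A x] lookup_lin_superset[of ?A y]
          sum.distrib distrib_right Poly_Mapping.keys_add)
qed

lemma lin_smul [simp]: "lin f (smul c x) = smul c (lin f x)"
proof (rule poly_mapping_eqI)
  fix h
  have "Poly_Mapping.keys (smul c x) \<subseteq> Poly_Mapping.keys x"
    by (auto simp: in_keys_iff)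
  then show "lkp (lin f (smul c x)) h = lkp (smul c (lin f x)) h"
    by (subst lookup_lin_superset[of "Poly_Mapping.keys x"])
       (auto simp: lookup_lin sum_distrib_left mult.assoc)
qed

lemma lin_uminus [simp]: "lin f (- x) = - lin f x"
proof -
  have "smul (- 1) x = - x" "smul (- 1) (lin f x) = - lin f x"
    by (auto intro!: poly_mapping_eqI)
  then show ?thesis
    using lin_smul[of f "- 1" x] by simp
qed

lemma lin_diff [simp]: "lin f (x - y) = lin f x - lin f y"
  using lin_add[of f x "- y"] by simp

lemma lin_sum: "lin f (sum h A) = (\<Sum>a\<in>A. lin f (h a))"
  by (induction A rule: infinite_finite_induct) auto

lemma lin_lin: "lin f (lin h x) = lin (\<lambda>g. lin f (h g)) x"
  by (simp add: lin_def[of h] lin_def[of "\<lambda>g. lin f (h g)"] lin_sum)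

text \<open>
  The linear extension of \<open>\<phi>\<close>.  Using \<open>lin\<close> with values in the free space on one generator makes the
  rules for \<open>lin\<close> apply.
\<close>

definition pairing :: "('g \<Rightarrow> 'k::field) \<Rightarrow> ('g \<Rightarrow>\<^sub>0 'k) \<Rightarrow> 'k"
  where "pairing \<phi> x = lkp (lin (\<lambda>g. smul (\<phi> g) (gen ())) x) ()"

lemma pairing_simps [simp]:
  "pairing \<phi> 0 = 0"
  "pairing \<phi> (gen g) = \<phi> g"
  "pairing \<phi> (x + y) = pairing \<phi> x + pairing \<phi> y"
  "pairing \<phi> (x - y) = pairing \<phi> x - pairing \<phi> y"
  "pairing \<phi> (- x) = - pairing \<phi> x"
  "pairing \<phi> (smul c x) = c * pairing \<phi> x"
  by (auto simp: pairing_def lookup_add lookup_minus)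

lemma pairing_sum: "pairing \<phi> (sum h A) = (\<Sum>a\<in>A. pairing \<phi> (h a))"
  by (induction A rule: infinite_finite_induct) auto

lemma pairing_eq: "pairing \<phi> x = (\<Sum>g\<in>Poly_Mapping.keys x. lkp x g * \<phi> g)"
  by (simp add: pairing_def lookup_lin)

lemma pairing_lin: "pairing \<phi> (lin f x) = pairing (\<lambda>g. pairing \<phi> (f g)) x"
  by (subst (2) pairing_eq) (simp add: lin_def pairing_sum)

lemma pairing_cong:
  "(\<And>g. g \<in> Poly_Mapping.keys x \<Longrightarrow> \<phi> g = \<psi> g) \<Longrightarrow> pairing \<phi> x = pairing \<psi> x"
  by (simp add: pairing_eq)

lemma pairing_eq_0: "(\<And>g. g \<in> Poly_Mapping.keys x \<Longrightarrow> \<phi> g = 0) \<Longrightarrow> pairing \<phi> x = 0"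
  by (simp add: pairing_eq)

lemma pairing_mult: "pairing (\<lambda>g. c * \<phi> g) x = c * pairing \<phi> x"
  by (simp add: pairing_eq sum_distrib_left algebra_simps)

lemma null_add: "x \<in> null M \<Longrightarrow> y \<in> null M \<Longrightarrow> x + y \<in> null M"
  and null_diff: "x \<in> null M \<Longrightarrow> y \<in> null M \<Longrightarrow> x - y \<in> null M"
  and null_uminus: "x \<in> null M \<Longrightarrow> - x \<in> null M"
  and null_0: "0 \<in> null M"
  and null_rels: "x \<in> rels M \<Longrightarrow> x \<in> null M"
  for M :: "('g, 'k::field, 'z) smod_scheme"
proof -
  interpret vector_space "smul :: 'k \<Rightarrow> ('g \<Rightarrow>\<^sub>0 'k) \<Rightarrow> _"
    by (rule vector_space_smul)
  show "x \<in> null M \<Longrightarrow> y \<in> null M \<Longrightarrow> x + y \<in> null M" "x \<in> null M \<Longrightarrow> y \<in> null M \<Longrightarrow> x - y \<in> null M"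
    "x \<in> null M \<Longrightarrow> - x \<in> null M" "0 \<in> null M" "x \<in> rels M \<Longrightarrow> x \<in> null M"
    unfolding null_def by (rule span_add span_diff span_neg span_zero span_base; assumption?)+
qed

lemma pairing_null:
  fixes M :: "('g, 'k::field, 'z) smod_scheme"
  assumes "\<And>r. r \<in> rels M \<Longrightarrow> pairing \<phi> r = 0" "x \<in> null M"
  shows "pairing \<phi> x = 0"
proof -
  interpret vector_space "smul :: 'k \<Rightarrow> ('g \<Rightarrow>\<^sub>0 'k) \<Rightarrow> _"
    by (rule vector_space_smul)
  have "lspan (rels M) \<subseteq> {x. pairing \<phi> x = 0}"
    by (rule span_minimal) (auto simp: assms(1) subspace_def)
  then show ?thesis
    using assms(2) unfolding null_def by auto
qed

lemma keys_lin_inj: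
  assumes "inj f"
  shows "Poly_Mapping.keys (lin (\<lambda>g. gen (f g)) x :: _ \<Rightarrow>\<^sub>0 'k::field) = f ` Poly_Mapping.keys x"
proof -
  have *: "lkp (lin (\<lambda>g. gen (f g)) x :: _ \<Rightarrow>\<^sub>0 'k) (f g) = lkp x g" for g
    unfolding lookup_lin using inj_eq[OF assms]
    by (simp add: lookup_single when_def in_keys_iff if_distrib[of "(*) _"] sum.delta cong: if_cong)
  have "h \<in> range f" if "h \<in> Poly_Mapping.keys (lin (\<lambda>g. gen (f g)) x :: _ \<Rightarrow>\<^sub>0 'k)" for h
  proof (rule ccontr)
    assume "h \<notin> range f"
    then have "lkp (lin (\<lambda>g. gen (f g)) x :: _ \<Rightarrow>\<^sub>0 'k) h = 0"
      unfolding lookup_lin by (intro sum.neutral) (auto simp: lookup_single when_def)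
    then show False using that by (simp add: in_keys_iff)
  qed
  then show ?thesis
    using * by (fastforce simp: in_keys_iff)
qed

lemma pairing_one_tensor:
  "pairing (\<lambda>_. 1) (tensor xs :: _ \<Rightarrow>\<^sub>0 'k::field) = prod_list (map (pairing (\<lambda>_. 1)) xs)"
proof (induction xs)
  case (Cons x xs)
  have "pairing (\<lambda>_. c) y = c * pairing (\<lambda>_. 1) y" for c :: 'k and y :: "'b \<Rightarrow>\<^sub>0 'k"
    using pairing_mult[of c "\<lambda>_. 1" y] by simp
  from this[of "pairing (\<lambda>_. 1) (tensor xs)" x] show ?case
    by (simp add: pairing_lin Cons mult.commute)
qed simp

lemma tensor_gen: "tensor (map (\<lambda>x. gen (f x)) xs) = gen (map f xs)"
  by (induction xs) auto

lemma tensor_0: "0 \<in> set zs \<Longrightarrow> tensor zs = 0"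
proof (induction zs)
  case (Cons z zs)
  show ?case
  proof (cases "z = 0")
    case False
    with Cons have "tensor zs = 0" by auto
    then show ?thesis by (simp add: lin_def)
  qed simp
qed simp

lemma comp_right_gen:
  assumes "\<And>h L. (h, L) \<in> set hs \<Longrightarrow> f h = gen (F h)"
  shows "comp_right f (g, hs) = gen (g, map (apfst F) hs)"
proof -
  have "map (\<lambda>(h, L). lin (\<lambda>h'. gen (h', L)) (f h)) hs = map (\<lambda>x. gen (apfst F x)) hs"
    using assms by (intro map_cong) auto
  then show ?thesis
    by (simp only: comp_right_def prod.case tensor_gen lin_gen)
qed

section \<open>Koszul signs and permutations\<close>

text \<open>
  Only pairs of odd elements contribute to a Koszul sign.  In all rearrangements below at most one factor, the
  one containing the tree, can have odd degree, since \<open>Com\<close> and \<open>I\<close> are concentrated in degree \<open>0\<close>.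
\<close>

lemma reorder_sign_one_odd:
  assumes "length (filter odd ds) \<le> 1" "set idx \<subseteq> {..<length ds}"
  shows "reorder_sign ds idx = 1"
proof -
  have odd_unique: "i = j" if "i < length ds" "j < length ds" "odd (ds ! i)" "odd (ds ! j)" for i j
  proof -
    have "card {i. i < length ds \<and> odd (ds ! i)} \<le> 1"
      using assms(1) by (simp add: length_filter_conv_card)
    then show ?thesis
      using that by (auto simp: card_le_Suc0_iff_eq)
  qed
  have "{(a, b). a < b \<and> b < length idx \<and> idx ! b < idx ! a \<and>
                         odd (ds ! (idx ! a)) \<and> odd (ds ! (idx ! b))} = {}"
  proof safe
    fix a b assume ab: "a < b" "b < length idx" "idx ! b < idx ! a"
      "odd (ds ! (idx ! a))" "odd (ds ! (idx ! b))"
    then have "idx ! a < length ds" "idx ! b < length ds"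
      using assms(2) by (auto simp: subset_iff)
    from odd_unique[OF this ab(4,5)] ab(3) show "(a, b) \<in> {}" by simp
  qed
  then show ?thesis by (simp only: reorder_sign_def card.empty power_0)
qed

lemma unshuffle_sign_even_lower: "(\<And>x. x \<in> set ab \<Longrightarrow> fst x = 0) \<Longrightarrow> unshuffle_sign ab = 1"
  by (auto simp: unshuffle_sign_def ksgn_def intro!: sum.neutral)

lemma ksgn_simps [simp]: "ksgn 0 = 1" "ksgn 1 = - 1" "ksgn (-1) = -1"
  by (auto simp: ksgn_def)

lemma mset_permute_list_by:
  assumes "\<sigma> permutes {..<n}" "length xs = n"
  shows "mset (permute_list_by \<sigma> xs) = mset xs"
proof -
  have "permute_list_by \<sigma> xs = permute_list (inv \<sigma>) xs"
    by (simp add: permute_list_by_def permute_list_def)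
  then show ?thesis
    using mset_permute_list[of "inv \<sigma>" xs] permutes_inv[OF assms(1)] assms(2) by simp
qed

lemma set_permute_list_by:
  "\<sigma> permutes {..<n} \<Longrightarrow> length xs = n \<Longrightarrow> set (permute_list_by \<sigma> xs) = set xs"
  using mset_permute_list_by[THEN arg_cong[where f = set_mset]] by simp

lemma length_permute_list_by [simp]: "length (permute_list_by \<sigma> xs) = length xs"
  by (simp add: permute_list_by_def)

lemma set_map_inv_permutes: "\<sigma> permutes {..<n} \<Longrightarrow> set (map (inv \<sigma>) [0..<n]) \<subseteq> {..<n}"
  using permutes_image[OF permutes_inv, of \<sigma> "{..<n}"] by (simp add: lessThan_atLeast0)

lemma reorder_sign_even:
  assumes "\<And>h. even (f h)" "\<sigma> permutes {..<length hs}"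
  shows "reorder_sign (map (\<lambda>(h, L). f h) hs) (map (inv \<sigma>) [0..<length hs]) = 1"
proof (rule reorder_sign_one_odd)
  have "filter odd (map (\<lambda>(h, L). f h) hs) = []"
    using assms(1) by (auto simp: filter_empty_conv)
  then show "length (filter odd (map (\<lambda>(h, L). f h) hs)) \<le> 1"
    by (simp only: list.size)
qed (use set_map_inv_permutes[OF assms(2)] in simp)

section \<open>Computation rules\<close>

text \<open>
  The record package defines constants \<open>extend\<close> that would otherwise shadow the extension of maps to free left
  modules.
\<close>

hide_const smod.extend operad.extend cooperad.extend dg_family.extend
hide_fact smod.extend_def operad.extend_def cooperad.extend_def dg_family.extend_def

lemma Com_simps [simp]:
  "gens Com = {1..}" "arity Com n = n" "deg Com n = 0" "act Com \<sigma> n = gen n" "dif Com n = 0"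
  "rels Com = {}" "gamma Com x = gen (length (labels x))" "id_op Com = 1"
  by (simp_all add: Com_def)

lemma bar_simps [simp]:
  "gens (bar P) = bar_gens P" "arity (bar P) t = length (leaves t)" "deg (bar P) t = tree_deg P t"
  "act (bar P) \<sigma> t = gen (relabel (inv \<sigma>) t)" "dif (bar P) t = bar_dif P t"
  "rels (bar P) = {r \<in> tree_rels P. Poly_Mapping.keys r \<subseteq> bar_gens P}"
  "counit (bar P) (Leaf l) = 1" "counit (bar P) (Node g ts) = 0"
  by (simp_all add: bar_def)

lemma copr_bar: "copr (bar P) t = (\<Sum>(s, lo, ups)\<leftarrow>cuts P t.
        smul s (gen (number_leaves 0 lo, map (\<lambda>u. (number_leaves 0 u, leaves u)) ups)))"
  by (simp add: bar_def)

lemma unit_smod_simps [simp]: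
  "gens unit_smod = UNIV" "arity unit_smod u = 1" "deg unit_smod u = 0" "act unit_smod \<sigma> u = gen u"
  "dif unit_smod u = 0" "rels unit_smod = {}"
  by (simp_all add: unit_smod_def)

lemma dsum_simps [simp]:
  "gens (dsum M N) = gens M <+> gens N"
  "arity (dsum M N) (Inl a) = arity M a" "arity (dsum M N) (Inr b) = arity N b"
  "deg (dsum M N) (Inl a) = deg M a" "deg (dsum M N) (Inr b) = deg N b"
  "act (dsum M N) \<sigma> (Inl a) = lin (\<lambda>x. gen (Inl x)) (act M \<sigma> a)"
  "act (dsum M N) \<sigma> (Inr b) = lin (\<lambda>x. gen (Inr x)) (act N \<sigma> b)"
  "dif (dsum M N) (Inl a) = lin (\<lambda>x. gen (Inl x)) (dif M a)"
  "dif (dsum M N) (Inr b) = lin (\<lambda>x. gen (Inr x)) (dif N b)"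
  "rels (dsum M N) = lin (\<lambda>x. gen (Inl x)) ` rels M \<union> lin (\<lambda>x. gen (Inr x)) ` rels N"
  by (simp_all add: dsum_def)

lemma scomp_simps [simp]:
  "gens (scomp M N) = scomp_gens M N"
  "arity (scomp M N) x = length (labels x)"
  "deg (scomp M N) (g, hs) = deg M g + (\<Sum>(h, L)\<leftarrow>hs. deg N h)"
  "act (scomp M N) \<sigma> (g, hs) = gen (g, map (apsnd (map (inv \<sigma>))) hs)"
  "rels (scomp M N) = scomp_rels M N"
  by (simp_all add: scomp_def)

lemma dif_scomp [simp]:
  "dif (scomp M N) (g, hs) = lin (\<lambda>g'. gen (g', hs)) (dif M g)
       + (\<Sum>i<length hs. smul (ksgn (deg M g + (\<Sum>(h, L)\<leftarrow>take i hs. deg N h)))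
            (lin (\<lambda>h'. gen (g, hs[i := (h', snd (hs ! i))])) (dif N (fst (hs ! i)))))"
  by (simp add: scomp_def)

lemma scomp_lin_simps [simp]:
  "gens (scomp_lin M N N') = scomp_gens M (dsum N N') \<inter> linear_gens"
  "arity (scomp_lin M N N') x = length (labels x)"
  "deg (scomp_lin M N N') x = deg (scomp M (dsum N N')) x"
  "act (scomp_lin M N N') = act (scomp M (dsum N N'))"
  "dif (scomp_lin M N N') = dif (scomp M (dsum N N'))"
  "rels (scomp_lin M N N') = {r \<in> scomp_rels M (dsum N N'). Poly_Mapping.keys r \<subseteq> linear_gens}"
  by (simp_all add: scomp_lin_def scomp_def)

lemma cotangent_simps [simp]:
  "gens (cotangent P C \<alpha>) = gens (scomp1 P (scomp C P))"
  "arity (cotangent P C \<alpha>) = arity (scomp1 P (scomp C P))"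
  "deg (cotangent P C \<alpha>) = deg (scomp1 P (scomp C P))"
  "act (cotangent P C \<alpha>) = act (scomp1 P (scomp C P))"
  "rels (cotangent P C \<alpha>) = rels (scomp1 P (scomp C P))"
  "dif (cotangent P C \<alpha>) x = dif (scomp1 P (scomp C P)) x - delta_left P C \<alpha> x + delta_right P C \<alpha> x"
  by (simp_all add: cotangent_def)

text \<open>
  Together with the default rules, these equations evaluate the differential of the cotangent complex on an explicit
  tree to an explicit sum of generators.
\<close>

lemmas evaluation = copr_bar comp1_right_def comp_left_def comp_right_def
  inf_id_def lessThan_Suc lessThan_nat_numeral eval_nat_numeral
  unshuffle_sign_def
  reorder_sign_one_odd partial_copr_def bar_proj_def eta_at_def gamma_at_def extend_def absorb_def
  left_action_def twist_left_def twist_right_def delta_left_def delta_right_def assoc_def left_unitor_def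
  labels_def lin_sum partial_comp_def upt_rec

section \<open>Relations of composition products\<close>

lemma scomp_relsE:
  assumes "r \<in> scomp_rels M N"
  obtains
    (root) r' hs where "r' \<in> rels M" "r = lin (\<lambda>g. gen (g, hs)) r'"
  | (branch) r' g xs L ys where "r' \<in> rels N" "r = lin (\<lambda>h. gen (g, xs @ (h, L) # ys)) r'"
  | (root_act) g hs \<sigma> where "length hs = arity M g" "\<sigma> permutes {..<length hs}"
      "r = lin (\<lambda>g'. gen (g', hs)) (act M \<sigma> g)
        - smul (reorder_sign (map (\<lambda>(h, L). deg N h) hs) (map (inv \<sigma>) [0..<length hs]))
               (gen (g, permute_list_by \<sigma> hs))"
  | (branch_act) g xs h L ys \<sigma> where
      "r = lin (\<lambda>h'. gen (g, xs @ (h', L) # ys)) (act N \<sigma> h)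
        - gen (g, xs @ (h, permute_list_by \<sigma> L) # ys)"
  using assms unfolding scomp_rels_def
  apply (elim IntE UnE CollectE exE conjE)
  subgoal by (rule root)
  subgoal by (rule branch)
  subgoal by (rule root_act) auto
  subgoal by (rule branch_act)
  done

lemma scomp_rels_rootI:
  "r' \<in> rels M \<Longrightarrow> r = lin (\<lambda>g. gen (g, hs)) r' \<Longrightarrow> Poly_Mapping.keys r \<subseteq> scomp_gens M N \<Longrightarrow>
    r \<in> scomp_rels M N"
  unfolding scomp_rels_def by blast

lemma scomp_rels_root_actI:
  assumes "g \<in> gens M" "length hs = arity M g" "\<sigma> permutes {..<arity M g}"
    and "r = lin (\<lambda>g'. gen (g', hs)) (act M \<sigma> g)
        - smul (reorder_sign (map (\<lambda>(h, L). deg N h) hs) (map (inv \<sigma>) [0..<length hs]))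
               (gen (g, permute_list_by \<sigma> hs))"
    and "Poly_Mapping.keys r \<subseteq> scomp_gens M N"
  shows "r \<in> scomp_rels M N"
  unfolding scomp_rels_def using assms by blast

lemma linear_gensE:
  assumes "(g, hs) \<in> linear_gens"
  obtains xs z L ys where "hs = xs @ (Inr z, L) # ys"
    "\<forall>h\<in>set xs. isl (fst h)" "\<forall>h\<in>set ys. isl (fst h)"
proof -
  from assms obtain h where "[h] = filter (\<lambda>(a, L). \<not> isl a) hs"
    by (auto simp: linear_gens_def length_Suc_conv)
  then obtain xs ys where *: "hs = xs @ h # ys" "\<not> isl (fst h)"
    "\<forall>h\<in>set xs. isl (fst h)" "filter (\<lambda>(a, L). \<not> isl a) ys = []"
    by (auto simp: Cons_eq_filter_iff case_prod_beta)
  from *(4) have "\<forall>h\<in>set ys. isl (fst h)"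
    by (auto simp: filter_empty_conv)
  with * that[of xs "projr (fst h)" "snd h" ys] show thesis
    by simp
qed

lemma linear_gens_one_odd:
  fixes N :: "('l, 'k::field, 'z) smod_scheme"
  assumes "(g, hs) \<in> linear_gens"
  shows "length (filter odd (map (\<lambda>(h, L). deg (dsum (unit_smod :: (unit, 'k) smod) N) h) hs)) \<le> 1"
proof -
  let ?f = "\<lambda>(h, L). deg (dsum (unit_smod :: (unit, 'k) smod) N) h"
  from assms obtain xs z L ys where hs: "hs = xs @ (Inr z, L) # ys"
    "\<forall>h\<in>set xs. isl (fst h)" "\<forall>h\<in>set ys. isl (fst h)"
    by (rule linear_gensE)
  have "filter odd (map ?f xs) = []" "filter odd (map ?f ys) = []"
    using hs by (auto simp: filter_empty_conv isl_def)
  then show ?thesis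
    using hs(1) by simp
qed

section \<open>The weight and its invariance\<close>

text \<open>
  The root of arity \<open>p\<close> to which the tree is attached is a parameter because \<open>c\<^sub>3\<close> counts under the identity only, and
  \<open>c\<^sub>2\<close> under the binary product only.  The two values agree since \<open>c\<^sub>3\<close> and \<open>x\<^sub>i \<cdot> c\<^sub>2(x\<^sub>j, x\<^sub>k)\<close> enter the differential
  of \<open>T\<^sub>i\<close> with opposite signs.
\<close>

definition corolla_weight :: "nat \<Rightarrow> nat tree \<Rightarrow> 'k::field" where
  "corolla_weight p t = (case t of Leaf _ \<Rightarrow> 0 | Node k ts \<Rightarrow>
     if (p = 1 \<or> p = 2) \<and> p + k = 4 \<and> (\<forall>u\<in>set ts. \<exists>l. u = Leaf l) then 1 else 0)"

definition branch_weight :: "nat \<Rightarrow> (nat tree, nat) two_level \<Rightarrow> 'k::field" where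
  "branch_weight p = (\<lambda>(t, qs). if \<forall>q\<in>set qs. fst q = 1 then corolla_weight p t else 0)"

text \<open>
  Summing over all factors makes the invariance under permutations of the factors immediate; a generator
  of the cotangent complex has a single factor that contributes (\<open>cot_weight_branch\<close>).
\<close>

definition cot_weight :: "(nat, nat tree) cot \<Rightarrow> 'k::field" where
  "cot_weight = (\<lambda>(p, hs). \<Sum>h\<leftarrow>hs. case_sum (\<lambda>_. 0) (branch_weight p) (fst h))"

abbreviation L_Com :: "((nat, nat tree) cot, 'k::field) smod" where
  "L_Com \<equiv> cotangent Com (bar Com) (bar_proj Com)"

text \<open>
  A permutation of the subtrees of a corolla is not accompanied by a sign, as leaves have degree \<open>0\<close>.
  Relations inside a larger tree involve no corolla at all: every tree occurring in a relation has a vertex,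
  and it is a proper subtree.
\<close>

lemma corolla_weight_tree_rels:
  assumes "r \<in> tree_rels (Com :: (nat, 'k::field) operad)"
  shows "Poly_Mapping.keys r \<subseteq> {t. \<forall>l. t \<noteq> Leaf l} \<and> pairing (corolla_weight p) r = 0"
  using assms
proof induction
  case (vertex r ts)
  then show ?case by simp
next
  case (equivariance g ts \<sigma>)
  then have len: "length ts = g" and \<sigma>: "\<sigma> permutes {..<g}"
    by auto
  let ?s = "reorder_sign (map (tree_deg (Com :: (nat, 'k) operad)) ts) (map (inv \<sigma>) [0..<length ts]) :: 'k"
  let ?ts = "permute_list_by \<sigma> ts"
  have "?s = 1" if "\<forall>u\<in>set ts. \<exists>l. u = Leaf l"
  proof (rule reorder_sign_one_odd)
    have "filter odd (map (tree_deg (Com :: (nat, 'k) operad)) ts) = []"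
      using that by (force simp: filter_empty_conv)
    then show "length (filter odd (map (tree_deg (Com :: (nat, 'k) operad)) ts)) \<le> 1"
      by simp
  qed (use set_map_inv_permutes[OF \<sigma>] len in simp)
  then have "corolla_weight p (Node g ts) = ?s * corolla_weight p (Node g ?ts)"
    using set_permute_list_by[OF \<sigma> len] by (auto simp: corolla_weight_def)
  moreover have "Poly_Mapping.keys (gen (Node g ts) - smul ?s (gen (Node g ?ts)))
      \<subseteq> {Node g ts, Node g ?ts}"
    by (auto simp: in_keys_iff lookup_minus lookup_single when_def split: if_splits)
  ultimately show ?case
    by auto
next
  case (inside r g xs ys)
  have "inj (\<lambda>t. Node g (xs @ t # ys))"
    by (auto intro: injI)
  moreover have "pairing (\<lambda>t. corolla_weight p (Node g (xs @ t # ys))) r = 0"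
    using inside.IH by (intro pairing_eq_0) (force simp: corolla_weight_def)
  ultimately show ?case
    by (auto simp: keys_lin_inj pairing_lin)
qed

lemma corolla_weight_relabel: "corolla_weight p (relabel f t) = corolla_weight p t"
proof (cases t)
  case (Node g ts)
  have "(\<exists>l. relabel f u = Leaf l) \<longleftrightarrow> (\<exists>l. u = Leaf l)" for u :: "nat tree"
    by (cases u) auto
  then show ?thesis
    by (simp add: Node corolla_weight_def)
qed (simp add: corolla_weight_def)

lemma branch_weight_scomp_rels:
  fixes r :: "_ \<Rightarrow>\<^sub>0 'k::field"
  assumes "r \<in> scomp_rels (bar Com) Com"
  shows "pairing (branch_weight p) r = 0"
proof -
  have bw: "branch_weight p (t, qs) = (if \<forall>q\<in>set qs. fst q = 1 then 1 else 0) * corolla_weight p t"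
    for t qs by (simp add: branch_weight_def)
  from assms show ?thesis
  proof (cases rule: scomp_relsE)
    case (root r' hs)
    then show ?thesis
      using corolla_weight_tree_rels[of r' p] by (simp add: pairing_lin bw pairing_mult)
  next
    case (root_act t hs \<sigma>)
    have sign: "reorder_sign (map (\<lambda>(h, L). 0) hs) (map (inv \<sigma>) [0..<length hs]) = (1 :: 'k)"
      using root_act(2) by (intro reorder_sign_even) auto
    from root_act show ?thesis
      using sign set_permute_list_by[of \<sigma> "length hs" hs]
      by (simp add: bw corolla_weight_relabel)
  qed (simp_all add: bw)
qed

lemma sum_list_isl:
  "\<forall>h\<in>set xs. isl (fst h) \<Longrightarrow> (\<Sum>h\<leftarrow>xs. case_sum (\<lambda>_. 0) f (fst h)) = (0 :: 'k::field)"
  by (induction xs) (auto simp: isl_def)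

lemma cot_weight_branch:
  assumes "\<forall>h\<in>set xs. isl (fst h)" "\<forall>h\<in>set ys. isl (fst h)"
  shows "cot_weight (p, xs @ (Inr z, L) # ys) = branch_weight p z"
  by (simp add: cot_weight_def sum_list_isl assms)

lemma cot_weight_permute:
  assumes "\<sigma> permutes {..<length hs}"
  shows "cot_weight (p, permute_list_by \<sigma> hs) = cot_weight (p, hs)"
  by (simp add: cot_weight_def sum_mset_sum_list[symmetric] mset_permute_list_by[OF assms refl])

lemma cot_weight_relabel: "cot_weight (p, map (apsnd f) hs) = cot_weight (p, hs)"
  by (simp add: cot_weight_def o_def)

lemma cot_weight_scomp_rels:
  fixes r :: "(nat, nat tree) cot \<Rightarrow>\<^sub>0 'k::field"
  assumes r: "r \<in> scomp_rels Com (dsum unit_smod (scomp (bar Com) Com))"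
    and linear: "Poly_Mapping.keys r \<subseteq> linear_gens"
  shows "pairing cot_weight r = 0"
  using r
proof (cases rule: scomp_relsE)
  case (root r' hs)
  then show ?thesis by simp
next
  case (branch r0 g xs L ys)
  then obtain r' where r': "r' \<in> scomp_rels (bar Com) Com" "r0 = lin (\<lambda>z. gen (Inr z)) r'"
    by auto
  have r: "r = lin (\<lambda>z. gen (g, xs @ (Inr z, L) # ys)) r'"
    by (simp add: branch(2) r'(2) lin_lin)
  have "inj (\<lambda>z. (g, xs @ (Inr z, L) # ys))"
    by (auto intro: injI)
  then have "Poly_Mapping.keys r = (\<lambda>z. (g, xs @ (Inr z, L) # ys)) ` Poly_Mapping.keys r'"
    unfolding r by (rule keys_lin_inj)
  with linear have lin: "(g, xs @ (Inr z, L) # ys) \<in> linear_gens" if "z \<in> Poly_Mapping.keys r'" for z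
    using that by auto
  have "cot_weight (g, xs @ (Inr z, L) # ys) = (branch_weight g z :: 'k)"
    if "z \<in> Poly_Mapping.keys r'" for z
    using lin[OF that] by (intro cot_weight_branch) (auto simp: linear_gens_def filter_empty_conv)
  then have "pairing (\<lambda>z. cot_weight (g, xs @ (Inr z, L) # ys)) r' = pairing (branch_weight g) r'"
    by (rule pairing_cong)
  then show ?thesis
    using branch_weight_scomp_rels[OF r'(1), of g] by (simp add: r pairing_lin)
next
  case (root_act g hs \<sigma>)
  let ?N = "dsum unit_smod (scomp (bar Com) Com) :: (_, 'k) smod"
  let ?s = "reorder_sign (map (\<lambda>(h, L). deg ?N h) hs) (map (inv \<sigma>) [0..<length hs]) :: 'k"
  show ?thesis
  proof (cases "(g, hs) \<in> linear_gens")
    case True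
    have "?s = 1"
      using set_map_inv_permutes[OF root_act(2)] linear_gens_one_odd[OF True]
      by (intro reorder_sign_one_odd) auto
    then show ?thesis
      using root_act by (simp add: cot_weight_permute)
  next
    case False
    \<comment> \<open>A term with no or several factors containing a tree is excluded, so the two terms cancel.\<close>
    with linear have "lkp r (g, hs) = 0"
      by (auto simp: in_keys_iff)
    then have "permute_list_by \<sigma> hs = hs \<and> ?s = 1"
      using root_act(3) by (auto simp: lookup_minus lookup_single when_def split: if_splits)
    then show ?thesis
      using root_act(3) by simp
  qed
next
  case (branch_act g xs h L ys \<sigma>)
  show ?thesis
  proof (cases h)
    case (Inl u)
    then show ?thesis using branch_act by (simp add: cot_weight_def)
  next
    case (Inr z)
    obtain t qs where z: "z = (t, qs)" by (cases z)
    have "branch_weight g (relabel f t, qs) = (branch_weight g (t, qs) :: 'k)"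
       "branch_weight g (t, map (apsnd (map (inv \<sigma>))) qs) = (branch_weight g (t, qs) :: 'k)" for f
      by (simp_all add: branch_weight_def corolla_weight_relabel)
    then show ?thesis
      using branch_act by (simp add: Inr z cot_weight_def)
  qed
qed

lemma cot_weight_scomp_unit_rels:
  fixes r :: "((nat, nat tree) cot, unit) two_level \<Rightarrow>\<^sub>0 'k::field"
  assumes "r \<in> scomp_rels L_Com unit_smod"
  shows "pairing (\<lambda>y. cot_weight (fst y)) r = 0"
  using assms
proof (cases rule: scomp_relsE)
  case (root r' hs)
  then show ?thesis
    by (simp add: pairing_lin cot_weight_scomp_rels)
next
  case (root_act m us \<sigma>)
  have sign: "reorder_sign (map (\<lambda>(h, L). 0) us) (map (inv \<sigma>) [0..<length us]) = (1 :: 'k)"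
    using root_act(2) by (intro reorder_sign_even) auto
  from root_act show ?thesis
    using sign by (cases m) (simp add: cot_weight_relabel)
qed simp_all

section \<open>The right action on the cotangent complex\<close>

lemma length_labels_consecutive: "length (labels (g, consecutive k xs)) = (\<Sum>x\<leftarrow>xs. snd x)"
  by (induction k xs rule: consecutive.induct) (auto simp: labels_def)

lemma length_consecutive [simp]: "length (consecutive k xs) = length xs"
  by (induction k xs rule: consecutive.induct) auto

lemma nth_consecutive:
  "i < length xs \<Longrightarrow> fst (consecutive k xs ! i) = fst (xs ! i) \<and>
    length (snd (consecutive k xs ! i)) = snd (xs ! i)"
  by (induction k xs arbitrary: i rule: consecutive.induct) (auto simp: nth_Cons split: nat.splits)

lemma consecutive_singleton [simp]: "consecutive k [x] = [(fst x, [k..<k + snd x])]"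
  by (cases x) simp

text \<open>
  The upper two levels of the three-level tree obtained from \<open>((g, hs), rs)\<close> by reassociation.
\<close>

definition regroup :: "('h \<times> nat list) list \<Rightarrow> ('l \<times> nat list) list \<Rightarrow>
    (('h, 'l) two_level \<times> nat list) list" where
  "regroup hs rs = map (\<lambda>(h, L). ((h, consecutive 0 (map (\<lambda>l. apsnd length (rs ! l)) L)),
                              concat (map (\<lambda>l. snd (rs ! l)) L))) hs"

lemma assoc_eq_gen:
  fixes N :: "('h, 'k::field, 'y) smod_scheme" and R :: "('l, 'k, 'z) smod_scheme"
  assumes "length (filter odd (map (\<lambda>(h, L). deg N h) hs)) \<le> 1" "\<And>r. even (deg R r)"
    and "set (labels (g, hs)) \<subseteq> {..<length rs}"
  shows "assoc N R ((g, hs), rs) = gen (g, regroup hs rs)"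
proof -
  have "filter odd (map (\<lambda>(r, K). deg R r) rs) = []"
    using assms(2) by (auto simp: filter_empty_conv)
  then have "length (filter odd (map (\<lambda>(h, L). deg N h) hs @ map (\<lambda>(r, K). deg R r) rs)) \<le> 1"
    using assms(1) by (simp only: filter_append append_Nil2)
  moreover have "set (concat (map (\<lambda>i. i # map ((+) (length hs)) (snd (hs ! i))) [0..<length hs]))
      \<subseteq> {..<length (map (\<lambda>(h, L). deg N h) hs @ map (\<lambda>(r, K). deg R r) rs)}"
    using assms(3) by (fastforce simp: labels_def)
  ultimately have "reorder_sign (map (\<lambda>(h, L). deg N h) hs @ map (\<lambda>(r, K). deg R r) rs)
      (concat (map (\<lambda>i. i # map ((+) (length hs)) (snd (hs ! i))) [0..<length hs])) = (1 :: 'k)"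
    by (rule reorder_sign_one_odd)
  then show ?thesis
    by (simp add: assoc_def regroup_def)
qed

lemma extend_Com_gen:
  fixes Y :: "('y, 'k::field, 'z) smod_scheme"
  assumes "\<And>h L. (h, L) \<in> set zs \<Longrightarrow> f h = gen (F h)"
  shows "extend Com Y f (p, zs) = gen (\<Sum>(h, L)\<leftarrow>zs. length (snd (F h)),
      concat (map (\<lambda>(h, L). map (apsnd (map ((!) L))) (snd (F h))) zs))"
proof -
  have "unshuffle_sign (map (\<lambda>x. (0, d x)) zs) = (1 :: 'k)" for d
    by (rule unshuffle_sign_even_lower) auto
  then show ?thesis
    by (simp add: extend_def comp_right_gen[OF assms] gamma_at_def length_labels_consecutive
        case_prod_unfold o_def)
qed

text \<open>
  The right action of \<open>Com\<close> on the factors in \<open>Com\<close> that are attached to a tree: arities add up.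
\<close>

definition merge :: "(nat \<times> nat list) list \<Rightarrow> (nat \<times> nat list) list \<Rightarrow> (nat \<times> nat list) list" where
  "merge qs rs = map (\<lambda>(q, K). (\<Sum>k\<leftarrow>K. length (snd (rs ! k)), concat (map (\<lambda>k. snd (rs ! k)) K))) qs"

abbreviation branch_action :: "((nat tree, nat) two_level, nat) two_level \<Rightarrow> (nat tree, nat) two_level \<Rightarrow>\<^sub>0 'k::field"
  where "branch_action y \<equiv> lin (comp_right (gamma Com)) (assoc (Com :: (nat, 'k) operad) (Com :: (nat, 'k) operad) y)"

lemma branch_action_gen:
  assumes "set (labels (c, qs)) \<subseteq> {..<length rs}"
  shows "(branch_action ((c, qs), rs) :: _ \<Rightarrow>\<^sub>0 'k::field) = gen (c, merge qs rs)"
proof -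
  have "assoc (Com :: (nat, 'k) operad) (Com :: (nat, 'k) operad) ((c, qs), rs) = gen (c, regroup qs rs)"
    using assms by (intro assoc_eq_gen) (auto simp: filter_map o_def case_prod_beta)
  then show ?thesis
    by (simp add: comp_right_gen[where F = "\<lambda>x. length (labels x)"] merge_def regroup_def
        length_labels_consecutive case_prod_unfold o_def)
qed

text \<open>
  The generator to which \<open>absorb\<close> maps a factor of the root: an input of the root becomes the operation
  grafted on it (\<open>rs\<close> has one entry then), and the factor containing the tree remains one factor, grafted on the identity.
\<close>

definition absorbed :: "(unit + (nat tree, nat) two_level, nat) two_level \<Rightarrow> (nat, nat tree) cot" where
  "absorbed = (\<lambda>(a, rs). case a of
     Inl _ \<Rightarrow> (fst (hd rs), map (\<lambda>l. (Inl (), [l])) (snd (hd rs)))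
   | Inr z \<Rightarrow> (1, [(Inr (fst z, merge (snd z) rs), [0..<length (labels (fst z, merge (snd z) rs))])]))"

abbreviation Branches :: "((nat tree, nat) two_level, 'k::field) smod"
  where "Branches \<equiv> scomp (bar Com) Com"

lemma absorb_gen:
  assumes "case a of Inl _ \<Rightarrow> length rs = 1 | Inr z \<Rightarrow> set (labels z) \<subseteq> {..<length rs}"
  shows "absorb Com Branches branch_action (a, rs) = (gen (absorbed (a, rs)) :: _ \<Rightarrow>\<^sub>0 'k::field)"
proof (cases a)
  case (Inl u)
  with assms show ?thesis
    by (auto simp: absorb_def absorbed_def length_Suc_conv)
next
  case (Inr z)
  obtain c qs where z: "z = (c, qs)" by (cases z)
  have "branch_action ((c, qs), rs) = (gen (c, merge qs rs) :: _ \<Rightarrow>\<^sub>0 'k)"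
    using assms by (intro branch_action_gen) (simp add: Inr z)
  then show ?thesis
    by (simp add: Inr z absorb_def absorbed_def eta_at_def)
qed

lemma L_Com_gensE:
  assumes "(p, hs) \<in> gens (L_Com :: (_, 'k::field) smod)"
  obtains xs t qs L ys where "hs = xs @ (Inr (t, qs), L) # ys"
    "\<forall>h\<in>set xs. isl (fst h)" "\<forall>h\<in>set ys. isl (fst h)"
    "\<forall>h\<in>set xs. length (snd h) = 1" "\<forall>h\<in>set ys. length (snd h) = 1"
    "p = length hs" "length L = length (labels (t, qs))" "set (labels (t, qs)) = {..<length L}"
    "t \<in> bar_gens (Com :: (nat, 'k) operad)" "length qs = length (leaves t)" "\<forall>q\<in>set qs. 1 \<le> fst q \<and> length (snd q) = fst q"
proof -
  from assms have lin: "(p, hs) \<in> linear_gens"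
    and gens: "(p, hs) \<in> scomp_gens (Com :: (nat, 'k) operad) (dsum unit_smod (Branches :: (_, 'k) smod))"
    by auto
  from lin obtain xs z L ys where hs: "hs = xs @ (Inr z, L) # ys"
    "\<forall>h\<in>set xs. isl (fst h)" "\<forall>h\<in>set ys. isl (fst h)"
    by (rule linear_gensE)
  obtain t qs where z: "z = (t, qs)" by (cases z)
  have "length (snd h) = 1" if "h \<in> set hs" "isl (fst h)" for h
    using gens that by (cases h) (force simp: scomp_gens_def isl_def)
  then have "\<forall>h\<in>set xs. length (snd h) = 1" "\<forall>h\<in>set ys. length (snd h) = 1"
    using hs by auto
  moreover have "p = length hs" and L: "length L = length (labels (t, qs))"
    and zg: "(t, qs) \<in> scomp_gens (bar (Com :: (nat, 'k) operad)) (Com :: (nat, 'k) operad)"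
    using gens by (auto simp: scomp_gens_def hs z)
  moreover have "set (labels (t, qs)) = {..<length L}"
    "t \<in> bar_gens (Com :: (nat, 'k) operad)" "length qs = length (leaves t)"
    "\<forall>q\<in>set qs. 1 \<le> fst q \<and> length (snd q) = fst q"
    using zg unfolding L by (auto simp: scomp_gens_def)
  ultimately show thesis
    using that[OF hs[unfolded z]] by blast
qed

lemma L_Com_gens_labels:
  assumes "(p, hs) \<in> gens (L_Com :: (_, 'k::field) smod)"
  shows "set (labels (p, hs)) = {..<length (labels (p, hs))}"
  using assms by (auto simp: scomp_gens_def)

lemma cotangent_action_gen:
  assumes "(p, hs) \<in> gens (L_Com :: (_, 'k::field) smod)" "length rs = length (labels (p, hs))"
  shows "cotangent_action Com (bar Com) ((p, hs), rs) = (gen (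
      \<Sum>(h, L)\<leftarrow>regroup hs rs. length (snd (absorbed h)),
      concat (map (\<lambda>(h, L). map (apsnd (map ((!) L))) (snd (absorbed h))) (regroup hs rs))) :: _ \<Rightarrow>\<^sub>0 'k)"
proof -
  from assms(1) obtain xs t qs L ys where hs: "hs = xs @ (Inr (t, qs), L) # ys"
    "\<forall>h\<in>set xs. isl (fst h)" "\<forall>h\<in>set ys. isl (fst h)"
    "\<forall>h\<in>set xs. length (snd h) = 1" "\<forall>h\<in>set ys. length (snd h) = 1"
    "p = length hs" "length L = length (labels (t, qs))" "set (labels (t, qs)) = {..<length L}"
    by (rule L_Com_gensE)
  have "assoc (dsum unit_smod Branches) (Com :: (nat, 'k) operad) ((p, hs), rs) = gen (p, regroup hs rs)"
  proof (rule assoc_eq_gen)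
    show "length (filter odd (map (\<lambda>(h, L). deg (dsum (unit_smod :: (_, 'k) smod) Branches) h) hs)) \<le> 1"
      by (rule linear_gens_one_odd) (use assms(1) in auto)
    show "set (labels (p, hs)) \<subseteq> {..<length rs}"
      using assms L_Com_gens_labels by auto
  qed simp
  moreover have "extend Com (dsum unit_smod Branches) (absorb Com Branches branch_action) (p, regroup hs rs)
     = (gen (
      \<Sum>(h, L)\<leftarrow>regroup hs rs. length (snd (absorbed h)),
      concat (map (\<lambda>(h, L). map (apsnd (map ((!) L))) (snd (absorbed h))) (regroup hs rs))) :: _ \<Rightarrow>\<^sub>0 'k)"
  proof (rule extend_Com_gen)
    fix h' L' assume "(h', L') \<in> set (regroup hs rs)"
    then obtain h K where hK: "(h, K) \<in> set hs" "h' = (h, consecutive 0 (map (\<lambda>l. apsnd length (rs ! l)) K))"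
      by (auto simp: regroup_def)
    show "absorb Com Branches branch_action h' = (gen (absorbed h') :: _ \<Rightarrow>\<^sub>0 'k)"
      unfolding hK(2)
    proof (rule absorb_gen)
      have "h = Inl () \<and> length K = 1 \<or> h = Inr (t, qs) \<and> K = L"
        using hK(1) hs by (force simp: isl_def)
      then show "case h of Inl _ \<Rightarrow> length (consecutive 0 (map (\<lambda>l. apsnd length (rs ! l)) K)) = 1
          | Inr z \<Rightarrow> set (labels z) \<subseteq> {..<length (consecutive 0 (map (\<lambda>l. apsnd length (rs ! l)) K))}"
        using hs by auto
    qed
  qed
  ultimately show ?thesis
    by (simp add: cotangent_action_def right_action_def)
qed

lemma branch_weight_fst:
  "map fst qs = map fst qs' \<Longrightarrow> branch_weight p (t, qs) = branch_weight p (t, qs')"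
proof -
  assume "map fst qs = map fst qs'"
  then have "(\<forall>q\<in>set (map fst qs). q = 1) = (\<forall>q\<in>set (map fst qs'). q = 1)"
    by (simp only:)
  then show ?thesis
    by (simp add: branch_weight_def)
qed

lemma branch_weight_large: "3 \<le> p \<Longrightarrow> branch_weight p z = 0"
  by (auto simp: branch_weight_def corolla_weight_def split: tree.split prod.split)

text \<open>
  Acting by identities preserves the weight.  An operation of arity at least \<open>2\<close> on an input of the root raises the
  arity of the root to at least \<open>3\<close>, and on an input of the tree it produces a factor of \<open>Com\<close> other
  than the identity; both kill the weight.
\<close>

lemma cot_weight_cotangent_action:
  fixes hs :: "((unit + (nat tree, nat) two_level) \<times> nat list) list"
  assumes gens: "(p, hs) \<in> gens (L_Com :: (_, 'k::field) smod)"
    and len: "length rs = length (labels (p, hs))" and pos: "\<forall>r\<in>set rs. 1 \<le> fst r \<and> length (snd r) = fst r"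
  shows "pairing cot_weight (cotangent_action Com (bar Com) ((p, hs), rs))
     = (if \<forall>r\<in>set rs. fst r = 1 then cot_weight (p, hs) else (0 :: 'k))"
proof -
  from gens obtain xs t qs L ys where hs: "hs = xs @ (Inr (t, qs), L) # ys"
    and isl: "\<forall>h\<in>set xs. isl (fst h)" "\<forall>h\<in>set ys. isl (fst h)"
    and single: "\<forall>h\<in>set xs. length (snd h) = 1" "\<forall>h\<in>set ys. length (snd h) = 1"
    and p: "p = length hs" and L: "length L = length (labels (t, qs))" "set (labels (t, qs)) = {..<length L}"
    and qs: "\<forall>q\<in>set qs. 1 \<le> fst q \<and> length (snd q) = fst q"
    by (rule L_Com_gensE)
  let ?n = "\<lambda>l. length (snd (rs ! l))"
  let ?m = "\<lambda>l. fst (rs ! l)"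
  let ?rs = "consecutive 0 (map (\<lambda>l. apsnd length (rs ! l)) L)"
  let ?N = "(\<Sum>h\<leftarrow>xs. ?n (hd (snd h))) + 1 + (\<Sum>h\<leftarrow>ys. ?n (hd (snd h)))"
  have rs_set: "set rs = (!) rs ` set (labels (p, hs))"
    using L_Com_gens_labels[OF gens] len by (auto simp: set_conv_nth)
  have N_part: "(\<Sum>(h, L)\<leftarrow>regroup xs rs. length (snd (absorbed h))) = (\<Sum>h\<leftarrow>xs. ?n (hd (snd h)))"
    if "\<forall>h\<in>set xs. isl (fst h)" "\<forall>h\<in>set xs. length (snd h) = 1"
    for xs :: "((unit + (nat tree, nat) two_level) \<times> nat list) list"
    using that by (induction xs) (auto simp: regroup_def absorbed_def length_Suc_conv isl_def)
  have zero_part: "(\<Sum>h\<leftarrow>concat (map (\<lambda>(h, L). map (apsnd (map ((!) L))) (snd (absorbed h))) (regroup xs rs)).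
      case_sum (\<lambda>_. 0) f (fst h)) = (0 :: 'k)"
    if "\<forall>h\<in>set xs. isl (fst h)"
    for xs :: "((unit + (nat tree, nat) two_level) \<times> nat list) list" and f
    using that by (induction xs) (auto simp: regroup_def absorbed_def isl_def o_def)
  have "pairing cot_weight (cotangent_action Com (bar Com) ((p, hs), rs))
      = (cot_weight (\<Sum>(h, L)\<leftarrow>regroup hs rs. length (snd (absorbed h)),
      concat (map (\<lambda>(h, L). map (apsnd (map ((!) L))) (snd (absorbed h))) (regroup hs rs))) :: 'k)"
    by (simp add: cotangent_action_gen[OF gens len])
  also have "(\<Sum>(h, L)\<leftarrow>regroup hs rs. length (snd (absorbed h))) = ?N"
    using N_part[OF isl(1) single(1)] N_part[OF isl(2) single(2)]
    by (simp add: hs regroup_def absorbed_def)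
  also have "cot_weight (?N, concat (map (\<lambda>(h, L). map (apsnd (map ((!) L))) (snd (absorbed h))) (regroup hs rs)))
      = (branch_weight ?N (t, merge qs ?rs) :: 'k)"
    using zero_part[OF isl(1)] zero_part[OF isl(2)]
    by (simp add: hs cot_weight_def regroup_def absorbed_def)
  also have "\<dots> = (if \<forall>r\<in>set rs. fst r = 1 then cot_weight (p, hs) else 0)"
  proof (cases "\<forall>r\<in>set rs. fst r = 1")
    case True
    have n1: "?n l = 1" if "l \<in> set (labels (p, hs))" for l
      using True pos rs_set that by auto
    have "(\<Sum>h\<leftarrow>zs. ?n (hd (snd h))) = length zs"
      if zs: "set zs \<subseteq> set hs" "\<forall>h\<in>set zs. length (snd h) = 1" for zs
    proof -
      have "?n (hd (snd h)) = 1" if "h \<in> set zs" for h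
      proof -
        have "snd h \<noteq> []"
          using zs(2) that by force
        then have "hd (snd h) \<in> set (labels (p, hs))"
          using zs(1) that by (auto simp: labels_def intro!: bexI[of _ h])
        then show ?thesis by (rule n1)
      qed
      then have "map (\<lambda>h. ?n (hd (snd h))) zs = map (\<lambda>_. 1) zs"
        by (intro map_cong) auto
      then show ?thesis
        by (simp only: sum_list_triv) simp
    qed
    from this[of xs] this[of ys] have
      "(\<Sum>h\<leftarrow>xs. ?n (hd (snd h))) = length xs" "(\<Sum>h\<leftarrow>ys. ?n (hd (snd h))) = length ys"
      using single by (auto simp: hs)
    then have "?N = p"
      by (simp add: p hs)
    have "map fst (merge qs ?rs) = map fst qs"
    proof -
      have "(\<Sum>k\<leftarrow>K. length (snd (?rs ! k))) = q" if "(q, K) \<in> set qs" for q K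
      proof -
        have "length (snd (?rs ! k)) = 1" if "k \<in> set K" for k
        proof -
          have "k \<in> set (labels (t, qs))"
            using \<open>(q, K) \<in> set qs\<close> that by (force simp: labels_def)
          then have "k < length L"
            using L(2) by simp
          then show ?thesis
            using nth_consecutive[of k "map (\<lambda>l. apsnd length (rs ! l)) L" 0] n1[of "L ! k"]
            by (simp add: hs labels_def)
        qed
        then have "map (\<lambda>k. length (snd (?rs ! k))) K = map (\<lambda>_. 1) K"
          by simp
        then show ?thesis
          using qs that by (auto simp: sum_list_triv simp del: map_eq_conv)
      qed
      then show ?thesis
        by (auto simp: merge_def)
    qed
    then have "branch_weight ?N (t, merge qs ?rs) = (branch_weight p (t, qs) :: 'k)"
      unfolding \<open>?N = p\<close> by (rule branch_weight_fst)
    also have "\<dots> = cot_weight (p, hs)"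
      unfolding hs by (rule cot_weight_branch[OF isl, symmetric])
    finally show ?thesis
      using True by simp
  next
    case False
    then obtain r where r: "r \<in> set rs" "fst r \<noteq> 1"
      by blast
    moreover from r obtain l where "l \<in> set (labels (p, hs))" "r = rs ! l"
      unfolding rs_set by blast
    ultimately have l: "l \<in> set (labels (p, hs))" "?n l \<noteq> 1"
      using pos by auto
    have n_pos: "?n l \<ge> 1" if "l \<in> set (labels (p, hs))" for l
      using pos rs_set that by auto
    with l have n2: "?n l \<ge> 2" by fastforce
    consider (left) h where "h \<in> set xs" "l \<in> set (snd h)" | (right) h where "h \<in> set ys" "l \<in> set (snd h)"
      | (branch) "l \<in> set L"
      using l(1) by (auto simp: hs labels_def)
    then have "branch_weight ?N (t, merge qs ?rs) = (0 :: 'k)"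
    proof cases
      case left
      then have "hd (snd h) = l"
        using single by (auto simp: length_Suc_conv)
      then have "?n l \<le> (\<Sum>h\<leftarrow>xs. ?n (hd (snd h)))"
        using left by (intro member_le_sum_list) auto
      then show ?thesis
        using n2 by (intro branch_weight_large) linarith
    next
      case right
      then have "hd (snd h) = l"
        using single by (auto simp: length_Suc_conv)
      then have "?n l \<le> (\<Sum>h\<leftarrow>ys. ?n (hd (snd h)))"
        using right by (intro member_le_sum_list) auto
      then show ?thesis
        using n2 by (intro branch_weight_large) linarith
    next
      case branch
      then obtain k where k: "k < length L" "L ! k = l"
        by (auto simp: in_set_conv_nth)
      then have "k \<in> set (labels (t, qs))"
        using L(2) by simp
      then obtain q K where qK: "(q, K) \<in> set qs" "k \<in> set K"
        by (auto simp: labels_def)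
      have "?n l = length (snd (?rs ! k))"
        using nth_consecutive[of k "map (\<lambda>l. apsnd length (rs ! l)) L" 0] k by simp
      also have "\<dots> \<le> (\<Sum>k\<leftarrow>K. length (snd (?rs ! k)))"
        using qK by (intro member_le_sum_list) auto
      finally have "(\<Sum>k\<leftarrow>K. length (snd (?rs ! k))) \<noteq> 1"
        using n2 by linarith
      then show ?thesis
        using qK(1) by (force simp: branch_weight_def merge_def)
    qed
    then show ?thesis
      using False by auto
  qed
  finally show ?thesis .
qed

section \<open>The weight vanishes on null vectors\<close>

abbreviation L_Com_bar :: "(((nat, nat tree) cot, unit) two_level, 'k::field) smod" where
  "L_Com_bar \<equiv> cotangent_bar Com (bar Com) (bar_proj Com)"

definition weight :: "((nat, nat tree) cot, unit) two_level \<Rightarrow> 'k::field" where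
  "weight y = cot_weight (fst y)"

lemma weight_comp_right:
  "pairing weight (comp_right f (m, zs)) = cot_weight m * prod_list (map (\<lambda>z. pairing (\<lambda>_. 1) (f (fst z))) zs)"
proof -
  have "pairing weight (comp_right f (m, zs)) = pairing (\<lambda>_. cot_weight m * 1) (tensor (map (\<lambda>(h, L). lin (\<lambda>h'. gen (h', L)) (f h)) zs))"
    by (simp add: comp_right_def pairing_lin weight_def)
  then show ?thesis
    unfolding pairing_mult pairing_one_tensor by (simp add: o_def case_prod_unfold pairing_lin)
qed

text \<open>
  Both sides of a relation of the relative composition product have the weight of the generator acted upon
  if all operations of \<open>Com\<close> in the middle level are identities, and weight \<open>0\<close> otherwise: on one side by
  \<open>cot_weight_cotangent_action\<close>, on the other by the definition of the augmentation.
\<close>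

lemma weight_rel_comp_rels:
  fixes y :: "(((nat, nat tree) cot, nat) two_level, unit) two_level"
  assumes "y \<in> gens (scomp (scomp (L_Com :: (_, 'k::field) smod) Com) unit_smod)"
  shows "pairing weight (comp_left (cotangent_action Com (bar Com)) y
    - lin (comp_right (unit_action Com)) (assoc Com unit_smod y)) = (0 :: 'k)"
proof -
  obtain p hs rs us where y: "y = (((p, hs), rs), us)" by (metis surj_pair)
  let ?C = "Com :: (nat, 'k) operad"
  have gens: "((p, hs), rs) \<in> scomp_gens (L_Com :: (_, 'k) smod) ?C"
    and us: "length us = length (labels ((p, hs), rs))"
    using assms unfolding y by (auto simp: scomp_gens_def)
  have m: "(p, hs) \<in> gens (L_Com :: (_, 'k) smod)"
    and rs: "length rs = length (labels (p, hs))" "\<forall>r\<in>set rs. 1 \<le> fst r \<and> length (snd r) = fst r"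
    and labels: "set (labels ((p, hs), rs)) = {..<length (labels ((p, hs), rs))}"
    using gens by (auto simp: scomp_gens_def simp del: cotangent_simps(1))
  have aug: "pairing (\<lambda>_. 1) (unit_action ?C z) = (if fst z = 1 then 1 else 0)" for z
    by (cases z) (simp add: unit_action_def aug_def)
  have "assoc ?C (unit_smod :: (unit, 'k) smod) (((p, hs), rs), us) = gen ((p, hs), regroup rs us)"
    using labels us by (intro assoc_eq_gen) (auto simp: filter_map o_def case_prod_beta)
  then have "pairing weight (lin (comp_right (unit_action ?C)) (assoc ?C (unit_smod :: (unit, 'k) smod) y)) =
      cot_weight (p, hs) * prod_list (map (\<lambda>r. if fst r = 1 then 1 else 0) rs)"
    by (simp add: y weight_comp_right aug regroup_def o_def case_prod_unfold)
  also have "prod_list (map (\<lambda>r. if fst r = 1 then 1 else 0) rs) = (if \<forall>r\<in>set rs. fst r = 1 then 1 else (0 :: 'k))"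
    by (induction rs) auto
  moreover have "pairing weight (comp_left (cotangent_action ?C (bar ?C)) y)
      = (if \<forall>r\<in>set rs. fst r = 1 then cot_weight (p, hs) else (0 :: 'k))"
    using cot_weight_cotangent_action[OF m rs] by (simp add: y comp_left_def pairing_lin weight_def)
  ultimately show ?thesis
    by simp
qed

lemma weight_null:
  assumes "x \<in> null L_Com_bar"
  shows "pairing weight x = 0"
proof (rule pairing_null[OF _ assms])
  fix r :: "_ \<Rightarrow>\<^sub>0 'a" assume "r \<in> rels L_Com_bar"
  then consider "r \<in> scomp_rels L_Com unit_smod"
    | y where "y \<in> gens (scomp (scomp (L_Com :: (_, 'a) smod) Com) unit_smod)"
      "r = comp_left (cotangent_action Com (bar Com)) y
    - lin (comp_right (unit_action Com)) (assoc Com unit_smod y)"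
    by (auto simp: cotangent_bar_def rel_comp_def)
  then show "pairing weight r = 0"
  proof cases
    case 1
    then show ?thesis using cot_weight_scomp_unit_rels unfolding weight_def[abs_def] by blast
  next
    case 2
    then show ?thesis using weight_rel_comp_rels by blast
  qed
qed

section \<open>The weight vanishes on boundaries\<close>

text \<open>
  A vertex with \<open>k\<close> inputs adds \<open>1\<close> to the degree and \<open>k - 1 \<ge> 1\<close> to the number of leaves.
\<close>

lemma tree_deg_le_leaves:
  "tree_ok (Com :: (nat, 'k::field) operad) t \<Longrightarrow>
    0 \<le> tree_deg (Com :: (nat, 'k) operad) t \<and> tree_deg (Com :: (nat, 'k) operad) t < length (leaves t)"
proof (induction t)
  case (Node g ts)
  have "0 \<le> (\<Sum>t\<leftarrow>us. tree_deg (Com :: (nat, 'k) operad) t) \<and>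
     (\<Sum>t\<leftarrow>us. tree_deg (Com :: (nat, 'k) operad) t) + length us \<le> (\<Sum>t\<leftarrow>us. length (leaves t))"
    if "set us \<subseteq> set ts" for us
    using that Node by (induction us) (fastforce simp: list_all_iff)+
  from this[of ts] Node.prems show ?case
    by (auto simp: length_concat o_def)
qed auto

lemma tree_one_leaf:
  "tree_ok (Com :: (nat, 'k::field) operad) t \<Longrightarrow> length (leaves t) = 1 \<Longrightarrow> \<exists>l. t = Leaf l"
proof (cases t)
  case (Node g ts)
  assume "tree_ok (Com :: (nat, 'k::field) operad) t" "length (leaves t) = 1"
  with tree_deg_le_leaves[where t = t] have "tree_deg (Com :: (nat, 'k) operad) t \<le> 0" by force
  moreover have "0 \<le> (\<Sum>t\<leftarrow>ts. tree_deg (Com :: (nat, 'k) operad) t)"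
    using \<open>tree_ok _ t\<close> tree_deg_le_leaves by (intro sum_list_nonneg) (force simp: Node list_all_iff)
  ultimately show ?thesis by (simp add: Node)
qed simp

lemma tree_ok_root:
  assumes "tree_ok (Com :: (nat, 'k::field) operad) (Node g ts)"
  shows "length ts = g \<and> 2 \<le> g \<and> g \<le> length (leaves (Node g ts))"
proof -
  have "length us \<le> (\<Sum>t\<leftarrow>us. length (leaves t))" if "set us \<subseteq> set ts" for us
    using that assms
    by (induction us) (use tree_deg_le_leaves[where ?'k = 'k] in \<open>fastforce simp: list_all_iff\<close>)+
  from this[of ts] assms show ?thesis
    by (auto simp: length_concat o_def)
qed

lemma tree_two_vertices:
  assumes "tree_ok (Com :: (nat, 'k::field) operad) t" "tree_deg (Com :: (nat, 'k) operad) t = 2"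
    "length (leaves t) = 3"
  shows "\<exists>a b c. t = Node 2 [Node 2 [Leaf a, Leaf b], Leaf c] \<or> t = Node 2 [Leaf a, Node 2 [Leaf b, Leaf c]]"
proof -
  let ?C = "Com :: (nat, 'k) operad"
  have binary: "\<exists>a b. u = Node 2 [Leaf a, Leaf b]"
    if u: "tree_ok ?C u" "length (leaves u) = 2" "tree_deg ?C u = 1" for u
  proof (cases u)
    case (Node g ts)
    then have "length ts = 2" and g: "g = 2"
      using tree_ok_root[where ?'k = 'k, of g ts] u by auto
    then obtain t1 t2 where ts: "ts = [t1, t2]"
      by (auto simp: numeral_2_eq_2 length_Suc_conv)
    have "length (leaves t1) \<ge> 1" "length (leaves t2) \<ge> 1"
      using tree_deg_le_leaves[where ?'k = 'k, of t1] tree_deg_le_leaves[where ?'k = 'k, of t2] u(1)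
      by (auto simp: Node ts)
    then have "length (leaves t1) = 1" "length (leaves t2) = 1"
      using u(2) by (auto simp: Node ts)
    then show ?thesis
      using tree_one_leaf[where ?'k = 'k, of t1] tree_one_leaf[where ?'k = 'k, of t2] u(1)
      by (auto simp: Node ts g)
  qed (use u in simp)
  obtain g ts where t: "t = Node g ts"
    using assms(3) by (cases t) auto
  have g: "length ts = g" "2 \<le> g" "g \<le> 3"
    using tree_ok_root[where ?'k = 'k, of g ts] assms by (auto simp: t)
  have bound: "0 \<le> tree_deg ?C u \<and> tree_deg ?C u < length (leaves u)" if "u \<in> set ts" for u
    using assms(1) that by (intro tree_deg_le_leaves) (auto simp: t list_all_iff)
  have ok: "tree_ok ?C u" if "u \<in> set ts" for u
    using assms(1) that by (auto simp: t list_all_iff)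
  consider "g = 2" | "g = 3"
    using g by linarith
  then show ?thesis
  proof cases
    case 1
    with g obtain t1 t2 where ts: "ts = [t1, t2]"
      by (auto simp: numeral_2_eq_2 length_Suc_conv)
    have sums: "length (leaves t1) + length (leaves t2) = 3" "tree_deg ?C t1 + tree_deg ?C t2 = 1"
      using assms by (auto simp: t ts)
    with bound[of t1] bound[of t2] consider
        "length (leaves t1) = 1" "length (leaves t2) = 2" "tree_deg ?C t2 = 1"
      | "length (leaves t1) = 2" "length (leaves t2) = 1" "tree_deg ?C t1 = 1"
      unfolding ts by fastforce
    then show ?thesis
      using binary[of t1] binary[of t2] ok[of t1] ok[of t2] tree_one_leaf[where ?'k = 'k, of t1]
        tree_one_leaf[where ?'k = 'k, of t2]
      by cases (auto simp: t ts 1)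
  next
    case 2
    with g obtain t1 t2 t3 where ts: "ts = [t1, t2, t3]"
      by (auto simp: numeral_3_eq_3 length_Suc_conv)
    have False
      using assms bound[of t1] bound[of t2] bound[of t3] by (auto simp: t ts)
    then show ?thesis ..
  qed
qed

lemma permutation_cases_3:
  assumes "{a, b, c} = {..<3 :: nat}"
  shows "(a, b, c) \<in> {(0,1,2),(0,2,1),(1,0,2),(1,2,0),(2,0,1),(2,1,0)}"
proof -
  have "0 \<in> {a, b, c}" "1 \<in> {a, b, c}" "2 \<in> {a, b, c}"
    unfolding assms by simp_all
  then show ?thesis
    by (elim insertE emptyE) simp_all
qed

text \<open>
  The differential is the sum of \<open>c\<^sub>3\<close> from contracting the inner edge, of \<open>-(x\<^sub>c \<cdot> c\<^sub>2)\<close> from \<open>\<delta>\<^sup>l\<close>, and of a term from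
  \<open>\<delta>\<^sup>r\<close> with a product on an input of \<open>c\<^sub>2\<close>, which has weight \<open>0\<close>.
\<close>

lemma weight_dif_left_comb:
  assumes "{a, b, c} = {..<3}"
  shows "pairing cot_weight (dif L_Com (1, [(Inr (Node 2 [Node 2 [Leaf a, Leaf b], Leaf c],
    [(1,[i]),(1,[j]),(1,[k])]),[u,v,w])])) = 0"
proof -
  from permutation_cases_3[OF assms] show ?thesis
    by (elim insertE emptyE Pair_inject; hypsubst)
      (simp_all add: evaluation cot_weight_def branch_weight_def corolla_weight_def)
qed

lemma weight_dif_right_comb:
  assumes "{a, b, c} = {..<3}"
  shows "pairing cot_weight (dif L_Com (1, [(Inr (Node 2 [Leaf a, Node 2 [Leaf b, Leaf c]],
    [(1,[i]),(1,[j]),(1,[k])]),[u,v,w])])) = 0"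
proof -
  from permutation_cases_3[OF assms] show ?thesis
    by (elim insertE emptyE Pair_inject; hypsubst)
      (simp_all add: evaluation cot_weight_def branch_weight_def corolla_weight_def)
qed

lemma dif_L_Com_bar:
  "dif L_Com_bar (m, us) = lin (\<lambda>m'. gen (m', us)) (dif L_Com m)"
  by (simp add: cotangent_bar_def rel_comp_def scomp_def)

text \<open>
  A tree of degree \<open>2\<close> has at least three leaves.  In arity \<open>3\<close> there is therefore no room for further inputs at the root or
  for products on the inputs of the tree, and the tree is binary.
\<close>

lemma weight_dif_eq_0:
  fixes y :: "((nat, nat tree) cot, unit) two_level"
  assumes "y \<in> gens (L_Com_bar :: (_, 'k::field) smod)"
    "arity (L_Com_bar :: (_, 'k) smod) y = 3" "deg (L_Com_bar :: (_, 'k) smod) y = 2"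
  shows "pairing weight (dif L_Com_bar y) = (0 :: 'k)"
proof -
  obtain p hs us where y: "y = ((p, hs), us)" by (metis surj_pair)
  let ?C = "Com :: (nat, 'k) operad"
  have gens: "((p, hs), us) \<in> scomp_gens (L_Com :: (_, 'k) smod) (unit_smod :: (_, 'k) smod)"
    using assms(1) by (simp add: y cotangent_bar_def rel_comp_def)
  have m: "(p, hs) \<in> gens (L_Com :: (_, 'k) smod)" and us: "length us = length (labels (p, hs))"
    "\<forall>u\<in>set us. length (snd u) = 1"
    using gens by (auto simp: scomp_gens_def simp del: cotangent_simps(1))
  from m obtain xs t qs L ys where hs: "hs = xs @ (Inr (t, qs), L) # ys"
    and isl: "\<forall>h\<in>set xs. isl (fst h)" "\<forall>h\<in>set ys. isl (fst h)"
    and single: "\<forall>h\<in>set xs. length (snd h) = 1" "\<forall>h\<in>set ys. length (snd h) = 1"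
    and p: "p = length hs" and L: "length L = length (labels (t, qs))"
    and t: "t \<in> bar_gens ?C" "length qs = length (leaves t)"
    and qs: "\<forall>q\<in>set qs. 1 \<le> fst q \<and> length (snd q) = fst q"
    by (rule L_Com_gensE)
  have len1: "length (concat (map snd zs)) = length zs" if "\<forall>h\<in>set zs. length (snd h) = 1" for zs :: "('z \<times> nat list) list"
    using that by (induction zs) auto
  have "length us = 3"
    using assms(2) len1[OF us(2)] by (simp add: y cotangent_bar_def rel_comp_def labels_def)
  then have total: "length xs + length L + length ys = 3"
    using us(1) len1[OF single(1)] len1[OF single(2)] by (simp add: hs labels_def)
  have "(\<Sum>h\<leftarrow>zs. deg (dsum (unit_smod :: (_, 'k) smod) (Branches :: (_, 'k) smod)) (fst h)) = 0" if "\<forall>h\<in>set zs. isl (fst h)" for zs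
    using that by (induction zs) (auto simp: isl_def)
  from this[OF isl(1)] this[OF isl(2)] have "deg (L_Com :: (_, 'k) smod) (p, hs) = tree_deg ?C t"
    by (simp add: hs case_prod_unfold)
  then have deg: "tree_deg ?C t = 2"
    using assms(3) by (simp add: y cotangent_bar_def rel_comp_def case_prod_unfold)
  have ok: "tree_ok ?C t"
    using t(1) by (simp add: bar_gens_def)
  have qs_le: "length rs \<le> length (concat (map snd rs))" if "\<forall>q\<in>set rs. 1 \<le> fst q \<and> length (snd q) = fst q" for rs :: "(nat \<times> nat list) list"
    using that by (induction rs) auto
  have "3 \<le> length (leaves t)"
    using tree_deg_le_leaves[OF ok] deg by simp
  then have "3 \<le> length (labels (t, qs))"
    using qs_le[OF qs] t(2) by (simp add: labels_def)
  then have "length xs = 0" "length ys = 0" and len: "length L = 3" and sum3: "length (labels (t, qs)) = 3"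
    using total L by linarith+
  then have xs: "xs = []" "ys = []"
    by simp_all
  have len: "length L = 3" "length (leaves t) = 3" "length qs = 3"
    using len sum3 qs_le[OF qs] \<open>3 \<le> length (leaves t)\<close> t(2) by (auto simp: labels_def)
  have sum3: "length (concat (map snd qs)) = 3"
    using sum3 by (simp add: labels_def)
  obtain u v w where uvw: "L = [u, v, w]"
    using len(1) by (auto simp: numeral_3_eq_3 length_Suc_conv)
  obtain i j k where ijk: "qs = [(1, [i]), (1, [j]), (1, [k])]"
  proof -
    obtain q1 q2 q3 where q: "qs = [q1, q2, q3]"
      using len(3) by (auto simp: numeral_3_eq_3 length_Suc_conv)
    then have "fst q1 = 1" "length (snd q1) = 1" "fst q2 = 1" "length (snd q2) = 1" "fst q3 = 1" "length (snd q3) = 1"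
      using qs sum3 by auto
    then show thesis
      using that q by (cases q1; cases q2; cases q3) (auto simp: length_Suc_conv)
  qed
  have leaves: "set (leaves t) = {..<3}"
    using t(1) len(2) by (simp add: bar_gens_def)
  have "pairing weight (dif L_Com_bar y) = (pairing cot_weight (dif L_Com (p, hs)) :: 'k)"
    by (simp add: y dif_L_Com_bar pairing_lin weight_def)
  also have "(p, hs) = (1, [(Inr (t, [(1, [i]), (1, [j]), (1, [k])]), [u, v, w])])"
    by (simp add: p hs xs ijk uvw)
  also have "pairing cot_weight (dif L_Com \<dots>) = (0 :: 'k)"
  proof -
    from tree_two_vertices[OF ok deg len(2)] obtain a b c where
      "t = Node 2 [Node 2 [Leaf a, Leaf b], Leaf c] \<or> t = Node 2 [Leaf a, Node 2 [Leaf b, Leaf c]]"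
      by blast
    then show ?thesis
    proof
      assume t: "t = Node 2 [Node 2 [Leaf a, Leaf b], Leaf c]"
      have "{a, b, c} = {..<3}"
        using leaves by (simp add: t)
      then show ?thesis
        unfolding t by (rule weight_dif_left_comb)
    next
      assume t: "t = Node 2 [Leaf a, Node 2 [Leaf b, Leaf c]]"
      have "{a, b, c} = {..<3}"
        using leaves by (simp add: t)
      then show ?thesis
        unfolding t by (rule weight_dif_right_comb)
    qed
  qed
  finally show ?thesis .
qed

section \<open>A cycle of weight one\<close>

abbreviation three_inputs :: "(unit \<times> nat list) list" where
  "three_inputs \<equiv> [((), [0]), ((), [1]), ((), [2])]"

text \<open>
  The generator \<open>d x\<close>: the trivial tree with the identity of \<open>Com\<close> on its input.
\<close>

abbreviation id_branch :: "(nat tree, nat) two_level" where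
  "id_branch \<equiv> (Leaf 0, [(1, [0])])"

lemma comp_right_augmentation_0:
  assumes "\<exists>r\<in>set rs. fst r \<noteq> 1"
  shows "(comp_right (unit_action Com) (m, regroup rs us) :: _ \<Rightarrow>\<^sub>0 'k::field) = 0"
proof -
  let ?f = "\<lambda>(h, L). lin (\<lambda>h'. gen (h', L)) (unit_action Com h) :: _ \<Rightarrow>\<^sub>0 'k"
  from assms obtain q K where "(q, K) \<in> set rs" "q \<noteq> 1"
    by auto
  then have "0 \<in> set (map ?f (regroup rs us))"
    by (force simp: regroup_def unit_action_def aug_def)
  then show ?thesis
    by (simp only: comp_right_def prod.case tensor_0 lin_0)
qed

text \<open>
  The image under the right action of a generator and operations that are not all identities is null, since
  the augmentation kills the other side of the relation.  The two summations are the explicit form of the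
  action in \<open>cotangent_action_gen\<close>.
\<close>

lemma decomposable_null:
  fixes hs :: "((unit + (nat tree, nat) two_level) \<times> nat list) list"
  assumes y: "(((p, hs), rs), us) \<in> gens (scomp (scomp (L_Com :: (_, 'k::field) smod) Com) unit_smod)"
    and "\<exists>r\<in>set rs. fst r \<noteq> 1"
  shows "gen ((\<Sum>(h, L)\<leftarrow>regroup hs rs. length (snd (absorbed h)),
      concat (map (\<lambda>(h, L). map (apsnd (map ((!) L))) (snd (absorbed h))) (regroup hs rs))), us)
    \<in> null (L_Com_bar :: (_, 'k) smod)" (is "gen (?z, us) \<in> _")
proof -
  let ?C = "Com :: (nat, 'k) operad"
  let ?I = "unit_smod :: (unit, 'k) smod"
  have rs: "set (labels ((p, hs), rs)) \<subseteq> {..<length us}"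
    and m: "(p, hs) \<in> gens (L_Com :: (_, 'k) smod)" "length rs = length (labels (p, hs))"
    using y by (auto simp: scomp_gens_def simp del: cotangent_simps(1))
  have "assoc ?C ?I (((p, hs), rs), us) = gen ((p, hs), regroup rs us)"
    using rs by (intro assoc_eq_gen) (auto simp: filter_map o_def case_prod_beta)
  then have "lin (comp_right (unit_action ?C)) (assoc ?C ?I (((p, hs), rs), us)) = 0"
    by (simp add: comp_right_augmentation_0[OF assms(2)])
  moreover have "comp_left (cotangent_action ?C (bar ?C)) (((p, hs), rs), us) = gen (?z, us)"
    by (simp add: comp_left_def cotangent_action_gen[OF m])
  ultimately have "gen (?z, us) = comp_left (cotangent_action ?C (bar ?C)) (((p, hs), rs), us)
      - lin (comp_right (unit_action ?C)) (assoc ?C ?I (((p, hs), rs), us))"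
    by simp
  also have "\<dots> \<in> rels (L_Com_bar :: (_, 'k) smod)"
    unfolding cotangent_bar_def rel_comp_def using y by (simp del: scomp_simps cotangent_simps) blast
  finally show ?thesis by (rule null_rels)
qed

lemmas explicit_gens = scomp_gens_def labels_def linear_gens_def bar_gens_def lessThan_Suc eval_nat_numeral insert_commute

lemmas explicit_action = regroup_def absorbed_def merge_def labels_def eval_nat_numeral upt_rec

lemma id_branch_last_null:
  "gen ((3, [(Inl (), [0]), (Inl (), [1]), (Inr id_branch, [2])]), three_inputs) \<in> null (L_Com_bar :: (_, 'k::field) smod)"
proof -
  have "(((2, [(Inl (), [0]), (Inr id_branch, [1])]), [(2, [0, 1]), (1, [2])]), three_inputs)
    \<in> gens (scomp (scomp (L_Com :: (_, 'k::field) smod) Com) unit_smod)"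
    by (auto simp: explicit_gens)
  from decomposable_null[OF this] show ?thesis
    by (simp add: explicit_action)
qed

lemma id_branch_first_null:
  assumes "{i, j, k} = {..<3}"
  shows "gen ((3, [(Inr id_branch, [i]), (Inl (), [j]), (Inl (), [k])]), three_inputs) \<in> null (L_Com_bar :: (_, 'k::field) smod)"
proof -
  have "(((2, [(Inr id_branch, [0]), (Inl (), [1])]), [(1, [i]), (2, [j, k])]), three_inputs)
    \<in> gens (scomp (scomp (L_Com :: (_, 'k::field) smod) Com) unit_smod)"
    using permutation_cases_3[OF assms] by (auto simp: explicit_gens)
  from decomposable_null[OF this] show ?thesis
    by (simp add: explicit_action)
qed

lemma product_branch_null:
  "gen ((1, [(Inr (Leaf 0, [(3, [0, 1, 2])]), [0, 1, 2])]), three_inputs) \<in> null (L_Com_bar :: (_, 'k::field) smod)"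
proof -
  have "(((1, [(Inr id_branch, [0])]), [(3, [0, 1, 2])]), three_inputs)
    \<in> gens (scomp (scomp (L_Com :: (_, 'k::field) smod) Com) unit_smod)"
    by (auto simp: explicit_gens)
  from decomposable_null[OF this] show ?thesis
    by (simp add: explicit_action)
qed

text \<open>
  The right action puts the inputs of one product next to each other, so the generator with the distinguished factor in
  the middle is not itself an image of the action; the commutativity of the root moves this factor to the front.
\<close>

lemma id_branch_middle_minus_first_null:
  "gen ((3, [(Inl (), [0]), (Inr id_branch, [1]), (Inl (), [2])]), three_inputs)
   - gen ((3, [(Inr id_branch, [1]), (Inl (), [0]), (Inl (), [2])]), three_inputs) \<in> null (L_Com_bar :: (_, 'k::field) smod)"
proof -
  let ?C = "Com :: (nat, 'k) operad"
  let ?hs = "[(Inl (), [0]), (Inr id_branch, [1]), (Inl (), [2])]"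
  let ?r = "gen (3, ?hs) - gen (3, [(Inr id_branch, [1]), (Inl (), [0]), (Inl (), [2])]) :: (nat, nat tree) cot \<Rightarrow>\<^sub>0 'k"
  let ?\<sigma> = "Transposition.transpose 0 (1 :: nat)"
  let ?N = "dsum unit_smod (Branches :: (_, 'k) smod)"
  have keys: "Poly_Mapping.keys ?r \<subseteq> scomp_gens ?C ?N \<inter> linear_gens"
    by (rule order.trans[OF keys_diff]) (auto simp: explicit_gens)
  have perm: "permute_list_by ?\<sigma> ?hs = [(Inr id_branch, [1]), (Inl (), [0]), (Inl (), [2])]"
    by (simp add: permute_list_by_def upt_rec transpose_def)
  have sign: "reorder_sign (map (\<lambda>(h, L). deg ?N h) ?hs) (map (inv ?\<sigma>) [0..<length ?hs]) = (1 :: 'k)"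
    by (rule reorder_sign_one_odd) (auto simp: transpose_def)
  have "?\<sigma> permutes {..<3}"
    by (rule permutes_swap_id) auto
  then have "?r \<in> scomp_rels ?C ?N"
  proof (intro scomp_rels_root_actI)
    show "?r = lin (\<lambda>p. gen (p, ?hs)) (act ?C ?\<sigma> 3)
        - smul (reorder_sign (map (\<lambda>(h, L). deg ?N h) ?hs) (map (inv ?\<sigma>) [0..<length ?hs]))
               (gen (3, permute_list_by ?\<sigma> ?hs))"
      unfolding sign perm by simp
  qed (use keys in auto)
  with keys have r: "?r \<in> rels (L_Com :: (_, 'k) smod)"
    by auto
  let ?r' = "lin (\<lambda>m. gen (m, three_inputs)) ?r :: _ \<Rightarrow>\<^sub>0 'k"
  have "?r' \<in> scomp_rels (L_Com :: (_, 'k) smod) (unit_smod :: (unit, 'k) smod)"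
  proof (rule scomp_rels_rootI[OF r refl])
    show "Poly_Mapping.keys ?r' \<subseteq> scomp_gens (L_Com :: (_, 'k) smod) (unit_smod :: (unit, 'k) smod)"
      unfolding lin_diff lin_gen by (rule order.trans[OF keys_diff]) (auto simp: explicit_gens)
  qed
  then have "?r' \<in> null (L_Com_bar :: (_, 'k) smod)"
    by (intro null_rels) (simp add: cotangent_bar_def rel_comp_def)
  then show ?thesis
    by simp
qed

abbreviation corolla_cycle :: "((nat, nat tree) cot, unit) two_level" where
  "corolla_cycle \<equiv> ((1, [(Inr (Node 3 [Leaf 0, Leaf 1, Leaf 2], [(1, [0]), (1, [1]), (1, [2])]), [0, 1, 2])]), three_inputs)"

text \<open>
  The differential of the corolla consists of the three terms \<open>\<mu>\<^sub>3(x, x, d x)\<close> of \<open>\<delta>\<^sup>l\<close> and the term \<open>d(x x x)\<close> of \<open>\<delta>\<^sup>r\<close>,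
  all of which are decomposable.
\<close>

lemma dif_corolla_cycle: "dif L_Com_bar corolla_cycle \<in> null (L_Com_bar :: (_, 'k::field) smod)"
proof -
  let ?first = "gen ((3, [(Inr id_branch, [0]), (Inl (), [1]), (Inl (), [2])]), three_inputs) :: _ \<Rightarrow>\<^sub>0 'k"
  let ?middle = "gen ((3, [(Inl (), [0]), (Inr id_branch, [1]), (Inl (), [2])]), three_inputs) :: _ \<Rightarrow>\<^sub>0 'k"
  let ?last = "gen ((3, [(Inl (), [0]), (Inl (), [1]), (Inr id_branch, [2])]), three_inputs) :: _ \<Rightarrow>\<^sub>0 'k"
  let ?product = "gen ((1, [(Inr (Leaf 0, [(3, [0, 1, 2])]), [0, 1, 2])]), three_inputs) :: _ \<Rightarrow>\<^sub>0 'k"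
  have "dif L_Com_bar corolla_cycle = ?product - ?first - ?middle - ?last"
    by (simp add: dif_L_Com_bar evaluation)
  moreover have "?middle \<in> null L_Com_bar"
    using null_add[OF id_branch_middle_minus_first_null id_branch_first_null[of 1 0 2]]
    by (simp add: lessThan_Suc eval_nat_numeral insert_commute)
  moreover have "?first \<in> null L_Com_bar"
    by (rule id_branch_first_null) (auto simp: lessThan_Suc eval_nat_numeral)
  ultimately show ?thesis
    using id_branch_last_null product_branch_null by (auto intro!: null_diff)
qed

theorem proposition6p1p1:
  shows "\<not> acyclic_dg (obstruction_module (Com :: (nat, 'k::field_char_0) operad)) \<and>
         \<not> homology_zero (obstruction_module (Com :: (nat, 'k) operad)) 1"
proof -
  let ?X = "obstruction_module (Com :: (nat, 'k) operad)"
  let ?x = "gen corolla_cycle :: _ \<Rightarrow>\<^sub>0 'k"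
  have X: "carr ?X n d = {x \<in> vectors L_Com_bar n d.
        lin (comp_left (cotangent_to_kaehler Com (bar (Com :: (nat, 'k) operad)))) x \<in> null (kaehler_bar Com)}"
    "nulls ?X = null L_Com_bar" "bd ?X = lin (dif L_Com_bar)" for n d
    by (simp_all add: obstruction_module_def obstruction_kernel_def kernel_def)
  have "corolla_cycle \<in> gens (L_Com_bar :: (_, 'k) smod)"
    by (auto simp: cotangent_bar_def rel_comp_def explicit_gens)
  moreover have "arity (L_Com_bar :: (_, 'k) smod) corolla_cycle = 3" "deg (L_Com_bar :: (_, 'k) smod) corolla_cycle = 1"
    by (simp_all add: cotangent_bar_def rel_comp_def labels_def)
  ultimately have "?x \<in> vectors L_Com_bar 3 1"
    by (simp add: vectors_def)
  moreover have "comp_left (cotangent_to_kaehler Com (bar (Com :: (nat, 'k) operad))) corolla_cycle = 0"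
    by (simp add: comp_left_def cotangent_to_kaehler_def comp1_right_def)
  ultimately have carr: "?x \<in> carr ?X 3 1"
    by (simp add: X null_0)
  have cycle: "?x \<in> cycles ?X 3 1"
    using carr dif_corolla_cycle by (simp add: cycles_def X(2,3))
  have not_boundary: "?x \<notin> boundaries ?X 3 1"
  proof
    assume "?x \<in> boundaries ?X 3 1"
    then obtain y where y: "y \<in> vectors (L_Com_bar :: (_, 'k) smod) 3 2" "?x - lin (dif L_Com_bar) y \<in> null L_Com_bar"
      by (auto simp: boundaries_def X)
    have "pairing weight (lin (dif L_Com_bar) y) = (0 :: 'k)"
      unfolding pairing_lin using y(1) by (intro pairing_eq_0 weight_dif_eq_0) (auto simp: vectors_def)
    then have "weight corolla_cycle = (0 :: 'k)"
      using weight_null[OF y(2)] by simp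
    then show False
      by (simp add: weight_def cot_weight_def branch_weight_def corolla_weight_def)
  qed
  have "homology ?X 3 1 \<noteq> {boundaries ?X 3 1}"
  proof
    let ?R = "{(x, y). x \<in> cycles ?X 3 1 \<and> y \<in> cycles ?X 3 1 \<and> x - y \<in> boundaries ?X 3 1}"
    assume "homology ?X 3 1 = {boundaries ?X 3 1}"
    moreover have "?R `` {?x} \<in> homology ?X 3 1"
      unfolding homology_def by (rule quotientI[OF cycle])
    moreover have "0 \<in> boundaries ?X 3 1"
      by (auto simp: boundaries_def X vectors_def null_0 intro!: exI[of _ 0])
    then have "?x \<in> ?R `` {?x}"
      using cycle by simp
    ultimately show False
      using not_boundary by auto
  qed
  then show ?thesis
    by (auto simp: acyclic_dg_def homology_zero_def)
qed

end
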